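(* Let $r\in\mathbb{N}$ and $k\in\mathbb{Z}_+$ with $k\leqslant r-1$. Then \[ \Gamma_{-1}=\Gamma\left(D^k_{-1};L_2^r\right)=\left\{\left(\left\|u_\lambda^{(r)}\right\|_2,\left\|u_\lambda\right\|_2\right):\ \lambda\geqslant 0\right\}. \]
   Context: Let $\mathbb{I}=[-1,1]$, $L_2=L_2(\mathbb{I})$ (real-valued functions) with norm $\|f\|_2=\left(\int_{-1}^1|f(x)|^2\,dx\right)^{1/2}$. For $m\in\mathbb{N}$, $L_2^m$ is the space of functions $f:\mathbb{I}\to\mathbb{R}$ having absolutely continuous derivative $f^{(m-1)}$ and such that $f^{(m)}\in L_2$. Let $W^r_2=\{f\in L_2^r:\|f^{(r)}\|_2\leqslant 1\}$. For $\lambda\geqslant 0$ (with $r,k$ fixed), $u_\lambda\in L_2^{2r}$ denotes the unique solution of the boundary value problem \[ \begin{cases}(-1)^ru^{(2r)}(x)+\lambda u(x)=0,& x\in(-1,1),\\ u^{(s)}(-1)=(-1)^{k-1}\delta_{r-k-1,s},& s=0,1,\ldots,r-1,\\ u^{(s)}(1)=0,& s=0,1,\ldots,r-1,\end{cases} \] where $\delta_{i,j}$ is the Kronecker symbol. $\Gamma_{-1}=\Gamma(D^k_{-1};L_2^r)$ is the set of all pairs $(A,B)$ of non-negative (finite) numbers such that the inequality $|f^{(k)}(-1)|\leqslant A\|f\|_2+B\|f^{(r)}\|_2$ holds for every $f\in L_2^r$ and is sharp in the sense that $B$ is the smallest possible for the given $A$, i.e. \[ B=B_{-1}(A)=\sup_{f\in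 W^r_2}\left(|f^{(k)}(-1)|-A\|f\|_2\right)<\infty . \] *)

theory Defs
  imports "HOL-Analysis.Analysis"
begin

abbreviation \<I> :: "real set" where
  "\<I> \<equiv> {-1..1}"

text \<open>
  The derivative relative to \<open>\<I>\<close> is one-sided at the end points.  Only its values at points of
  \<open>\<I>\<close> where the function is differentiable are meaningful; \<^const>\<open>vector_derivative\<close> is
  unspecified elsewhere, so differentiability is always required separately.
\<close>

definition deriv_I :: "nat \<Rightarrow> (real \<Rightarrow> real) \<Rightarrow> real \<Rightarrow> real" where
  "deriv_I j f = ((\<lambda>g x. vector_derivative g (at x within \<I>)) ^^ j) f"

definition abs_cont_on :: "real set \<Rightarrow> (real \<Rightarrow> real) \<Rightarrow> bool" where
  "abs_cont_on S f \<longleftrightarrow>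
     (\<forall>\<epsilon>>0. \<exists>\<delta>>0. \<forall>(n::nat) a b.
        (\<forall>i<n. a i \<le> b i \<and> {a i..b i} \<subseteq> S) \<longrightarrow>
        disjoint_family_on (\<lambda>i. {a i<..<b i}) {..<n} \<longrightarrow>
        (\<Sum>i<n. b i - a i) < \<delta> \<longrightarrow>
        (\<Sum>i<n. \<bar>f (b i) - f (a i)\<bar>) < \<epsilon>)"

definition L2 :: "(real \<Rightarrow> real) set" where
  "L2 = {f. f \<in> borel_measurable (lebesgue_on \<I>) \<and> integrable (lebesgue_on \<I>) (\<lambda>x. (f x)\<^sup>2)}"

definition norm2 :: "(real \<Rightarrow> real) \<Rightarrow> real" where
  "norm2 f = sqrt (\<integral>x. \<bar>f x\<bar>\<^sup>2 \<partial>lebesgue_on \<I>)"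

text \<open>
  The space \<open>L\<^sub>2\<^sup>m\<close> for \<open>m \<ge> 1\<close>.  Functions on \<open>\<I>\<close> are represented by extensional functions, so
  that equality of functions is equality on \<open>\<I>\<close>.  The derivative of order \<open>m\<close> is only an almost
  everywhere defined function.
\<close>

definition L2_space :: "nat \<Rightarrow> (real \<Rightarrow> real) set" where
  "L2_space m = {f \<in> extensional \<I>.
     (\<forall>j<m - 1. \<forall>x\<in>\<I>. deriv_I j f differentiable (at x within \<I>)) \<and>
     abs_cont_on \<I> (deriv_I (m - 1) f) \<and>
     (AE x in lebesgue_on \<I>. deriv_I (m - 1) f differentiable (at x within \<I>)) \<and>
     deriv_I m f \<in> L2}"

definition W_class :: "nat \<Rightarrow> (real \<Rightarrow> real) set" where
  "W_class r = {f \<in> L2_space r. norm2 (deriv_I r f) \<le> 1}"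

text \<open>The sign \<open>(-1)\<^bsup>k-1\<^esup>\<close> needs an integer exponent, since \<open>k = 0\<close> is allowed.\<close>

definition bvp_solution :: "nat \<Rightarrow> nat \<Rightarrow> real \<Rightarrow> (real \<Rightarrow> real) \<Rightarrow> bool" where
  "bvp_solution r k lam u \<longleftrightarrow>
     u \<in> L2_space (2 * r) \<and>
     (\<forall>x\<in>{-1<..<1}. deriv_I (2 * r - 1) u differentiable (at x within \<I>) \<and>
        (-1) ^ r * deriv_I (2 * r) u x + lam * u x = 0) \<and>
     (\<forall>s<r. deriv_I s u (-1) = (if s = r - k - 1 then (-1) powi (int k - 1) else 0)) \<and>
     (\<forall>s<r. deriv_I s u 1 = 0)"

definition u_sol :: "nat \<Rightarrow> nat \<Rightarrow> real \<Rightarrow> real \<Rightarrow> real" where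
  "u_sol r k lam = (THE u. bvp_solution r k lam u)"

definition B_left :: "nat \<Rightarrow> nat \<Rightarrow> real \<Rightarrow> ereal" where
  "B_left r k A = (SUP f\<in>W_class r. ereal (\<bar>deriv_I k f (-1)\<bar> - A * norm2 f))"

definition Gamma_left :: "nat \<Rightarrow> nat \<Rightarrow> (real \<times> real) set" where
  "Gamma_left r k = {(A, B). A \<ge> 0 \<and> B \<ge> 0 \<and>
     (\<forall>f\<in>L2_space r. \<bar>deriv_I k f (-1)\<bar> \<le> A * norm2 f + B * norm2 (deriv_I r f)) \<and>
     ereal B = B_left r k A}"

end

theory Submission
  imports Defs
begin

text \<open>
  Integrating by parts against the solution \<open>u\<close> of the boundary value problem gives, for every
  \<open>f\<close> in the space, \<open>D\<^sup>k f(-1) = \<langle>f, D\<^sup>r u\<rangle> - (-1)\<^sup>r \<langle>D\<^sup>r f, u\<rangle>\<close>, so by Cauchy--Schwarz the pair of norms is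
  admissible.  Equality holds for \<open>f = D\<^sup>r u\<close>, because \<open>D\<^sup>r f = D\<^sup>2\<^sup>r u\<close> is a multiple of \<open>u\<close>; if
  \<open>\<lambda> = 0\<close> then \<open>D\<^sup>r f = 0\<close>, which forces \<open>A \<ge> \<parallel>D\<^sup>r u\<^sub>0\<parallel>\<close> for every admissible pair.  It remains to
  see that \<open>\<parallel>D\<^sup>r u\<^sub>\<lambda>\<parallel>\<close> takes all values from \<open>\<parallel>D\<^sup>r u\<^sub>0\<parallel>\<close> on.  It is continuous in \<open>\<lambda>\<close> by an energy
  estimate for differences of solutions.  It is unbounded because \<open>u\<^sub>\<lambda>\<close> minimises
  \<open>\<parallel>D\<^sup>r v\<parallel>\<^sup>2 + \<lambda> \<parallel>v\<parallel>\<^sup>2\<close> under the boundary conditions, whence \<open>\<parallel>u\<^sub>\<lambda>\<parallel> \<rightarrow> 0\<close>, while \<open>f \<mapsto> D\<^sup>k f(-1)\<close> is not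
  bounded in the norm of \<open>L\<^sub>2\<close>.
\<close>

subsection \<open>Absolutely continuous functions\<close>

text \<open>Transfers the definition from initial segments of the naturals to arbitrary finite index
  sets, so that it applies directly to the tagged intervals of a division.\<close>

lemma abs_cont_onE_finite:
  assumes "abs_cont_on S f" "e > 0"
  obtains d where "d > 0"
    "\<forall>(Q :: 'i set) a b. finite Q \<longrightarrow> (\<forall>i\<in>Q. a i \<le> b i \<and> {a i..b i} \<subseteq> S) \<longrightarrow>
       disjoint_family_on (\<lambda>i. {a i<..<b i}) Q \<longrightarrow> (\<Sum>i\<in>Q. b i - a i) < d \<longrightarrow>
       (\<Sum>i\<in>Q. \<bar>f (b i) - f (a i)\<bar>) < e"
proof -
  obtain d where d: "d > 0" and *: "\<And>(n::nat) a b. (\<forall>i<n. a i \<le> b i \<and> {a i..b i} \<subseteq> S) \<Longrightarrow>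
        disjoint_family_on (\<lambda>i. {a i<..<b i}) {..<n} \<Longrightarrow>
        (\<Sum>i<n. b i - a i) < d \<Longrightarrow> (\<Sum>i<n. \<bar>f (b i) - f (a i)\<bar>) < e"
    using assms(1)[unfolded abs_cont_on_def, rule_format, OF assms(2)] by blast
  show thesis
  proof (rule that[OF d], intro allI impI)
    fix Q :: "'i set" and a b
    assume Q: "finite Q" "\<forall>i\<in>Q. a i \<le> b i \<and> {a i..b i} \<subseteq> S"
      "disjoint_family_on (\<lambda>i. {a i<..<b i}) Q" "(\<Sum>i\<in>Q. b i - a i) < d"
    obtain h where h: "bij_betw h {..<card Q} Q"
      using ex_bij_betw_nat_finite[OF Q(1)] by (auto simp: atLeast0LessThan)
    have inj: "inj_on h {..<card Q}" and hQ: "\<And>i. i < card Q \<Longrightarrow> h i \<in> Q"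
      using h by (auto simp: bij_betw_def)
    have "(\<Sum>i<card Q. \<bar>f (b (h i)) - f (a (h i))\<bar>) < e"
    proof (rule *)
      show "disjoint_family_on (\<lambda>i. {a (h i)<..<b (h i)}) {..<card Q}"
        unfolding disjoint_family_on_def
      proof (intro ballI impI)
        fix i j assume "i \<in> {..<card Q}" "j \<in> {..<card Q}" "i \<noteq> j"
        then have "h i \<in> Q" "h j \<in> Q" "h i \<noteq> h j" using hQ inj by (auto simp: inj_on_def)
        then show "{a (h i)<..<b (h i)} \<inter> {a (h j)<..<b (h j)} = {}"
          using Q(3) unfolding disjoint_family_on_def by blast
      qed
      show "(\<Sum>i<card Q. b (h i) - a (h i)) < d"
        using Q(4) sum.reindex_bij_betw[OF h, of "\<lambda>i. b i - a i"] by simp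
    qed (use Q hQ in auto)
    then show "(\<Sum>i\<in>Q. \<bar>f (b i) - f (a i)\<bar>) < e"
      using sum.reindex_bij_betw[OF h, of "\<lambda>i. \<bar>f (b i) - f (a i)\<bar>"] by simp
  qed
qed

lemma abs_cont_on_subset:
  assumes "abs_cont_on S f" "T \<subseteq> S"
  shows "abs_cont_on T f"
  unfolding abs_cont_on_def
proof (intro allI impI)
  fix e :: real assume "e > 0"
  obtain d where d: "d > 0" "\<And>(n::nat) a b. (\<forall>i<n. a i \<le> b i \<and> {a i..b i} \<subseteq> S) \<Longrightarrow>
        disjoint_family_on (\<lambda>i. {a i<..<b i}) {..<n} \<Longrightarrow>
        (\<Sum>i<n. b i - a i) < d \<Longrightarrow> (\<Sum>i<n. \<bar>f (b i) - f (a i)\<bar>) < e"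
    using assms(1)[unfolded abs_cont_on_def, rule_format, OF \<open>e > 0\<close>] by blast
  show "\<exists>d>0. \<forall>(n::nat) a b. (\<forall>i<n. a i \<le> b i \<and> {a i..b i} \<subseteq> T) \<longrightarrow>
        disjoint_family_on (\<lambda>i. {a i<..<b i}) {..<n} \<longrightarrow>
        (\<Sum>i<n. b i - a i) < d \<longrightarrow> (\<Sum>i<n. \<bar>f (b i) - f (a i)\<bar>) < e"
  proof (intro exI[of _ d] conjI allI impI d(1))
    fix n :: nat and a b
    assume *: "\<forall>i<n. a i \<le> b i \<and> {a i..b i} \<subseteq> T"
      and "disjoint_family_on (\<lambda>i. {a i<..<b i}) {..<n}" "(\<Sum>i<n. b i - a i) < d"
    then show "(\<Sum>i<n. \<bar>f (b i) - f (a i)\<bar>) < e"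
      using * assms(2) by (intro d(2)) (auto dest: subset_trans[OF _ assms(2)] simp del: atLeastatMost_subset_iff)
  qed
qed

lemma abs_cont_on_pair:
  assumes "abs_cont_on {a..b} f" "e > 0"
  obtains d where "d > 0"
    "\<And>x y. x \<in> {a..b} \<Longrightarrow> y \<in> {a..b} \<Longrightarrow> \<bar>x - y\<bar> < d \<Longrightarrow> \<bar>f x - f y\<bar> < e"
proof -
  obtain d where d: "d > 0"
    "\<forall>(Q :: unit set) a' b'. finite Q \<longrightarrow> (\<forall>i\<in>Q. a' i \<le> b' i \<and> {a' i..b' i} \<subseteq> {a..b}) \<longrightarrow>
       disjoint_family_on (\<lambda>i. {a' i<..<b' i}) Q \<longrightarrow> (\<Sum>i\<in>Q. b' i - a' i) < d \<longrightarrow>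
       (\<Sum>i\<in>Q. \<bar>f (b' i) - f (a' i)\<bar>) < e"
    by (rule abs_cont_onE_finite[OF assms])
  have *: "\<bar>f y - f x\<bar> < e" if "x \<in> {a..b}" "y \<in> {a..b}" "x \<le> y" "y - x < d" for x y
    using d(2)[rule_format, of "{()}" "\<lambda>_. x" "\<lambda>_. y"] that by (auto simp: disjoint_family_on_def)
  show thesis
  proof (rule that[OF d(1)])
    fix x y assume xy: "x \<in> {a..b}" "y \<in> {a..b}" "\<bar>x - y\<bar> < d"
    show "\<bar>f x - f y\<bar> < e"
    proof (cases "x \<le> y")
      case True
      then show ?thesis using *[of x y] xy by (simp add: abs_minus_commute)
    next
      case False
      then show ?thesis using *[of y x] xy by simp
    qed
  qed
qed

lemma abs_cont_on_imp_continuous_on: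
  assumes "abs_cont_on {a..b} f"
  shows "continuous_on {a..b} f"
  unfolding continuous_on_iff dist_real_def
proof (intro ballI allI impI)
  fix x e :: real assume x: "x \<in> {a..b}" and "e > 0"
  obtain d where "d > 0" "\<And>x y. x \<in> {a..b} \<Longrightarrow> y \<in> {a..b} \<Longrightarrow> \<bar>x - y\<bar> < d \<Longrightarrow> \<bar>f x - f y\<bar> < e"
    using abs_cont_on_pair[OF assms \<open>e > 0\<close>] by blast
  then show "\<exists>d>0. \<forall>x'\<in>{a..b}. \<bar>x' - x\<bar> < d \<longrightarrow> \<bar>f x' - f x\<bar> < e"
    using x by blast
qed

text \<open>
  The gauge argument: tags outside the exceptional null set are handled by differentiability, and
  the intervals tagged in the null set lie in an open set of small measure, where absolute
  continuity bounds the increments.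
\<close>

theorem abs_cont_fundamental_theorem_of_calculus:
  assumes ab: "a \<le> b" and ac: "abs_cont_on {a..b} f" and N: "negligible N"
    and der: "\<And>x. x \<in> {a..b} - N \<Longrightarrow> (f has_vector_derivative f' x) (at x within {a..b})"
  shows "(f' has_integral (f b - f a)) {a..b}"
proof -
  \<comment> \<open>With the value 0 on \<open>N\<close>, intervals tagged in \<open>N\<close>
    contribute nothing to the Riemann sum, and only the increments of \<open>f\<close> over them
    remain to be estimated.\<close>
  define g where "g x = (if x \<in> N then 0 else f' x)" for x
  have "(g has_integral (f b - f a)) (cbox a b)"
    unfolding has_integral
  proof (intro allI impI)
    fix e :: real assume "e > 0"
    \<comment> \<open>The summand 1 keeps the denominator positive when
      \<open>a = b\<close>.\<close>
    define e' where "e' = e / (2 * (b - a + 1))"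
    have e': "e' > 0" and e'b: "e' * (b - a) < e / 2"
      using \<open>e > 0\<close> ab by (auto simp: e'_def field_simps)
    obtain d where d: "d > 0"
      "\<forall>(Q :: (real \<times> real set) set) a' b'. finite Q \<longrightarrow> (\<forall>i\<in>Q. a' i \<le> b' i \<and> {a' i..b' i} \<subseteq> {a..b}) \<longrightarrow>
       disjoint_family_on (\<lambda>i. {a' i<..<b' i}) Q \<longrightarrow> (\<Sum>i\<in>Q. b' i - a' i) < d \<longrightarrow>
       (\<Sum>i\<in>Q. \<bar>f (b' i) - f (a' i)\<bar>) < e / 2"
      using \<open>e > 0\<close> by (rule abs_cont_onE_finite[OF ac half_gt_zero])
    obtain G where G: "open G" "N \<subseteq> G" "G \<in> lmeasurable" "measure lebesgue G < d"
    proof -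
      obtain T where T: "open T" "N \<subseteq> T" "T - N \<in> lmeasurable" "emeasure lebesgue (T - N) < ennreal d"
        using sets_lebesgue_outer_open[OF negligible_imp_sets[OF N] d(1)] by blast
      have eq: "T = (T - N) \<union> N" using T(2) by blast
      have "T \<in> lmeasurable"
        using T(3) negligible_imp_measurable[OF N] by (subst eq) (rule fmeasurable.Un)
      moreover have "measure lebesgue T = measure lebesgue (T - N)"
        using N by (metis measure_Diff_null_set T(1) lborelD negligible_iff_null_sets borel_open sets_completionI_sets)
      moreover have "measure lebesgue (T - N) < d"
        using T(4) d(1) by (simp add: emeasure_eq_measure2 T(3) ennreal_less_iff)
      ultimately show thesis using T that by simp
    qed
    have "\<exists>c>0. x \<in> {a..b} - N \<longrightarrow>
       (\<forall>y\<in>{a..b}. \<bar>y - x\<bar> < c \<longrightarrow> \<bar>f y - f x - (y - x) * f' x\<bar> \<le> e' * \<bar>y - x\<bar>)" for x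
    proof (cases "x \<in> {a..b} - N")
      case True
      then show ?thesis
        using der[OF True, unfolded has_vector_derivative_def has_derivative_within_alt] e' by auto
    qed (auto intro: exI[of _ 1])
    then obtain c where c: "\<And>x. c x > 0" "\<And>x y. x \<in> {a..b} - N \<Longrightarrow> y \<in> {a..b} \<Longrightarrow> \<bar>y - x\<bar> < c x \<Longrightarrow>
        \<bar>f y - f x - (y - x) * f' x\<bar> \<le> e' * \<bar>y - x\<bar>"
      by metis
    define \<gamma> where "\<gamma> x = (if x \<in> N then G else ball x (c x))" for x
    have "gauge \<gamma>"
      using G c(1) by (auto simp: gauge_def \<gamma>_def)
    moreover have "norm ((\<Sum>(x, K)\<in>p. measure lborel K *\<^sub>R g x) - (f b - f a)) < e"
      if p: "p tagged_division_of cbox a b" and fine: "\<gamma> fine p" for p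
    proof -
      have fin: "finite p" using p by blast
      have K: "\<exists>u v. K = {u..v} \<and> u \<le> x \<and> x \<le> v \<and> {u..v} \<subseteq> {a..b}" if "(x, K) \<in> p" for x K
        using p that by (metis atLeastAtMost_iff box_real(2) tagged_division_ofD(2,3,4))
      define Q where "Q = {z \<in> p. fst z \<in> N}"
      have Qp: "Q \<subseteq> p" and finQ: "finite Q" using fin by (auto simp: Q_def)
      have fsum: "f b - f a = (\<Sum>(x,K)\<in>p. f (Sup K) - f (Inf K))"
        and lsum: "b - a = (\<Sum>(x,K)\<in>p. Sup K - Inf K)"
        using additive_tagged_division_1[OF ab, of p f] additive_tagged_division_1[OF ab, of p "\<lambda>x. x"] p
        by auto
      have disj: "disjoint_family_on (\<lambda>z. {Inf (snd z)<..<Sup (snd z)}) Q"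
        unfolding disjoint_family_on_def
      proof (intro ballI impI)
        fix z w assume zw: "z \<in> Q" "w \<in> Q" "z \<noteq> w"
        obtain x L y M where zw': "z = (x, L)" "w = (y, M)" by (metis surj_pair)
        have "interior L \<inter> interior M = {}"
          using tagged_division_ofD(5)[OF p, of x L y M] zw zw' Qp by auto
        moreover obtain u v u' v' where "L = {u..v}" "u \<le> v" "M = {u'..v'}" "u' \<le> v'"
          using K[of x L] K[of y M] zw zw' Qp by (metis order_trans subsetD)
        ultimately show "{Inf (snd z)<..<Sup (snd z)} \<inter> {Inf (snd w)<..<Sup (snd w)} = {}"
          using zw' by (auto simp: interior_atLeastAtMost_real)
      qed
      have sub: "{Inf (snd z)<..<Sup (snd z)} \<subseteq> G" if "z \<in> Q" for z
      proof -
        obtain x L where z: "z = (x, L)" by force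
        then have xL: "(x, L) \<in> p" "x \<in> N" using that by (auto simp: Q_def)
        then have "L \<subseteq> G" using fineD[OF fine xL(1)] by (simp add: \<gamma>_def)
        then show ?thesis using K[OF xL(1)] z by fastforce
      qed
      have QK: "Inf (snd z) \<le> Sup (snd z) \<and> {Inf (snd z)..Sup (snd z)} \<subseteq> {a..b}" if "z \<in> Q" for z
      proof -
        have "(fst z, snd z) \<in> p" using that Qp by auto
        then obtain u v where "snd z = {u..v}" "u \<le> v" "{u..v} \<subseteq> {a..b}"
          using K by (metis order_trans)
        then show ?thesis by simp
      qed
      have "(\<Sum>z\<in>Q. Sup (snd z) - Inf (snd z)) = (\<Sum>z\<in>Q. measure lebesgue {Inf (snd z)<..<Sup (snd z)})"
        using QK by (intro sum.cong) auto
      also have "\<dots> = measure lebesgue (\<Union>z\<in>Q. {Inf (snd z)<..<Sup (snd z)})"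
        using QK by (intro measure_finite_Union[symmetric] finQ disj) auto
      also have "\<dots> \<le> measure lebesgue G"
        using sub G(3) by (intro measure_mono_fmeasurable) (auto intro!: sets.countable_UN' countable_finite finQ)
      also have "\<dots> < d" by fact
      finally have Q2: "(\<Sum>z\<in>Q. \<bar>f (Sup (snd z)) - f (Inf (snd z))\<bar>) < e / 2"
        using d(2)[rule_format, OF finQ, of "\<lambda>z. Inf (snd z)" "\<lambda>z. Sup (snd z)"] QK disj by simp
      have bound: "\<bar>measure lborel (snd z) * g (fst z) - (f (Sup (snd z)) - f (Inf (snd z)))\<bar>
          \<le> e' * (Sup (snd z) - Inf (snd z))" if "z \<in> p - Q" for z
      proof -
        obtain x L where z: "z = (x, L)" by force
        have xL: "(x, L) \<in> p" "x \<notin> N" using that z by (auto simp: Q_def)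
        obtain u v where uv: "L = {u..v}" "u \<le> x" "x \<le> v" "{u..v} \<subseteq> {a..b}" using K[OF xL(1)] by blast
        have "L \<subseteq> ball x (c x)" using fineD[OF fine xL(1)] xL(2) by (simp add: \<gamma>_def)
        moreover have "u \<in> L" "v \<in> L" using uv by auto
        ultimately have "u \<in> ball x (c x)" "v \<in> ball x (c x)" by blast+
        then have "\<bar>u - x\<bar> < c x" "\<bar>v - x\<bar> < c x" by (auto simp: dist_real_def)
        moreover have "x \<in> {a..b} - N" "u \<in> {a..b}" "v \<in> {a..b}" using uv xL(2) by auto
        ultimately have "\<bar>f u - f x - (u - x) * f' x\<bar> \<le> e' * \<bar>u - x\<bar>"
          "\<bar>f v - f x - (v - x) * f' x\<bar> \<le> e' * \<bar>v - x\<bar>"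
          using c(2) by blast+
        \<comment> \<open>Straddle estimate: the tag lies between \<open>u\<close> and
          \<open>v\<close>, so the two distances add up to the length of the interval.\<close>
        then have "\<bar>(v - u) * f' x - (f v - f u)\<bar> \<le> e' * \<bar>u - x\<bar> + e' * \<bar>v - x\<bar>"
          by (simp add: algebra_simps)
        also have "\<dots> = e' * (v - u)" using uv by (simp add: algebra_simps)
        finally show ?thesis using z uv xL by (simp add: g_def)
      qed
      have "(\<Sum>(x, K)\<in>p. measure lborel K *\<^sub>R g x) - (f b - f a)
        = (\<Sum>z\<in>p. measure lborel (snd z) * g (fst z) - (f (Sup (snd z)) - f (Inf (snd z))))"
        unfolding fsum by (simp add: sum_subtractf case_prod_unfold)
      also have "\<dots> = (\<Sum>z\<in>Q. measure lborel (snd z) * g (fst z) - (f (Sup (snd z)) - f (Inf (snd z)))) +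
        (\<Sum>z\<in>p - Q. measure lborel (snd z) * g (fst z) - (f (Sup (snd z)) - f (Inf (snd z))))"
        using sum.subset_diff[OF Qp fin] by (simp add: add.commute)
      also have "\<bar>\<dots>\<bar> \<le> (\<Sum>z\<in>Q. \<bar>f (Sup (snd z)) - f (Inf (snd z))\<bar>) + (\<Sum>z\<in>p - Q. e' * (Sup (snd z) - Inf (snd z)))"
      proof (rule order_trans[OF abs_triangle_ineq add_mono])
        show "\<bar>\<Sum>z\<in>Q. measure lborel (snd z) * g (fst z) - (f (Sup (snd z)) - f (Inf (snd z)))\<bar>
            \<le> (\<Sum>z\<in>Q. \<bar>f (Sup (snd z)) - f (Inf (snd z))\<bar>)"
          by (rule order_trans[OF sum_abs]) (auto simp: Q_def g_def intro!: sum_mono)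
        show "\<bar>\<Sum>z\<in>p - Q. measure lborel (snd z) * g (fst z) - (f (Sup (snd z)) - f (Inf (snd z)))\<bar>
            \<le> (\<Sum>z\<in>p - Q. e' * (Sup (snd z) - Inf (snd z)))"
          by (rule order_trans[OF sum_abs sum_mono]) (rule bound)
      qed
      also have "(\<Sum>z\<in>p - Q. e' * (Sup (snd z) - Inf (snd z))) \<le> (\<Sum>z\<in>p. e' * (Sup (snd z) - Inf (snd z)))"
      proof (intro sum_mono2 fin)
        fix z assume "z \<in> p - (p - Q)"
        then have "z \<in> Q" by blast
        then show "0 \<le> e' * (Sup (snd z) - Inf (snd z))" using QK e' by simp
      qed auto
      also have "\<dots> = e' * (b - a)"
        unfolding lsum by (simp add: sum_distrib_left case_prod_unfold)
      finally show ?thesis using Q2 e'b by simp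
    qed
    ultimately show "\<exists>\<gamma>. gauge \<gamma> \<and> (\<forall>\<D>. \<D> tagged_division_of cbox a b \<and> \<gamma> fine \<D> \<longrightarrow>
        norm ((\<Sum>(x, k)\<in>\<D>. measure lborel k *\<^sub>R g x) - (f b - f a)) < e)"
      by (intro exI[of _ \<gamma>]) simp
  qed
  then have "(g has_integral (f b - f a)) {a..b}" by simp
  then show ?thesis
    by (rule has_integral_spike[OF N, rotated]) (simp add: g_def)
qed

text \<open>A common source for sums, differences, products and Lipschitz functions: increments
  dominated by those of two absolutely continuous functions inherit smallness, each of the two
  receiving the budget \<open>e / (2 * K)\<close>.\<close>

lemma abs_cont_on_dominated:
  assumes f: "abs_cont_on S f" and g: "abs_cont_on S g" and K: "K > 0"
    and h: "\<And>x y. x \<in> S \<Longrightarrow> y \<in> S \<Longrightarrow> \<bar>h y - h x\<bar> \<le> K * \<bar>f y - f x\<bar> + K * \<bar>g y - g x\<bar>"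
  shows "abs_cont_on S h"
  unfolding abs_cont_on_def
proof (intro allI impI)
  fix e :: real assume "e > 0"
  then have e: "e / (2 * K) > 0" using K by simp
  obtain d1 where d1: "d1 > 0" "\<forall>(n::nat) a b. (\<forall>i<n. a i \<le> b i \<and> {a i..b i} \<subseteq> S) \<longrightarrow>
        disjoint_family_on (\<lambda>i. {a i<..<b i}) {..<n} \<longrightarrow>
        (\<Sum>i<n. b i - a i) < d1 \<longrightarrow> (\<Sum>i<n. \<bar>f (b i) - f (a i)\<bar>) < e / (2 * K)"
    using f[unfolded abs_cont_on_def, rule_format, OF e] by blast
  obtain d2 where d2: "d2 > 0" "\<forall>(n::nat) a b. (\<forall>i<n. a i \<le> b i \<and> {a i..b i} \<subseteq> S) \<longrightarrow>
        disjoint_family_on (\<lambda>i. {a i<..<b i}) {..<n} \<longrightarrow>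
        (\<Sum>i<n. b i - a i) < d2 \<longrightarrow> (\<Sum>i<n. \<bar>g (b i) - g (a i)\<bar>) < e / (2 * K)"
    using g[unfolded abs_cont_on_def, rule_format, OF e] by blast
  show "\<exists>d>0. \<forall>(n::nat) a b. (\<forall>i<n. a i \<le> b i \<and> {a i..b i} \<subseteq> S) \<longrightarrow>
        disjoint_family_on (\<lambda>i. {a i<..<b i}) {..<n} \<longrightarrow>
        (\<Sum>i<n. b i - a i) < d \<longrightarrow> (\<Sum>i<n. \<bar>h (b i) - h (a i)\<bar>) < e"
  proof (intro exI[of _ "min d1 d2"] conjI allI impI)
    fix n :: nat and a b
    assume ab: "\<forall>i<n. a i \<le> b i \<and> {a i..b i} \<subseteq> S"
      and disj: "disjoint_family_on (\<lambda>i. {a i<..<b i}) {..<n}"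
      and len: "(\<Sum>i<n. b i - a i) < min d1 d2"
    have 1: "(\<Sum>i<n. \<bar>f (b i) - f (a i)\<bar>) < e / (2 * K)"
      using d1(2)[rule_format, of n a b, OF _ disj] ab len by simp
    have 2: "(\<Sum>i<n. \<bar>g (b i) - g (a i)\<bar>) < e / (2 * K)"
      using d2(2)[rule_format, of n a b, OF _ disj] ab len by simp
    have "(\<Sum>i<n. \<bar>h (b i) - h (a i)\<bar>)
       \<le> (\<Sum>i<n. K * \<bar>f (b i) - f (a i)\<bar> + K * \<bar>g (b i) - g (a i)\<bar>)"
    proof (intro sum_mono h)
      fix i assume "i \<in> {..<n}"
      then have "a i \<le> b i" "{a i..b i} \<subseteq> S" using ab by auto
      then show "a i \<in> S" "b i \<in> S" by (auto simp: subset_iff)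
    qed
    also have "\<dots> = K * (\<Sum>i<n. \<bar>f (b i) - f (a i)\<bar>) + K * (\<Sum>i<n. \<bar>g (b i) - g (a i)\<bar>)"
      by (simp add: sum.distrib sum_distrib_left)
    also have "\<dots> < K * (e / (2 * K)) + K * (e / (2 * K))"
      using 1 2 K by (intro add_strict_mono mult_strict_left_mono)
    also have "\<dots> = e" using K by (simp add: field_simps)
    finally show "(\<Sum>i<n. \<bar>h (b i) - h (a i)\<bar>) < e" .
  qed (use d1 d2 in auto)
qed

lemma abs_cont_on_lipschitz:
  assumes "K > 0" "\<And>x y. x \<in> S \<Longrightarrow> y \<in> S \<Longrightarrow> \<bar>h y - h x\<bar> \<le> K * \<bar>y - x\<bar>"
  shows "abs_cont_on S h"
proof (rule abs_cont_on_dominated[OF _ _ \<open>K > 0\<close>])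
  show id: "abs_cont_on S (\<lambda>x. x)"
    unfolding abs_cont_on_def
  proof (intro allI impI)
    fix e :: real assume "e > 0"
    show "\<exists>d>0. \<forall>(n::nat) a b. (\<forall>i<n. a i \<le> b i \<and> {a i..b i} \<subseteq> S) \<longrightarrow>
        disjoint_family_on (\<lambda>i. {a i<..<b i}) {..<n} \<longrightarrow>
        (\<Sum>i<n. b i - a i) < d \<longrightarrow> (\<Sum>i<n. \<bar>b i - a i\<bar>) < e"
      using \<open>e > 0\<close> by (intro exI[of _ e]) auto
  qed
  show "abs_cont_on S (\<lambda>x. x)" by (fact id)
  fix x y assume "x \<in> S" "y \<in> S"
  then have "\<bar>h y - h x\<bar> \<le> K * \<bar>y - x\<bar>" by (rule assms)
  then show "\<bar>h y - h x\<bar> \<le> K * \<bar>y - x\<bar> + K * \<bar>y - x\<bar>"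
    using \<open>K > 0\<close> by (simp add: add_increasing2)
qed

lemma abs_cont_on_add:
  assumes "abs_cont_on S f" "abs_cont_on S g"
  shows "abs_cont_on S (\<lambda>x. f x + g x)"
  by (rule abs_cont_on_dominated[OF assms, of 1]) auto

lemma abs_cont_on_sum:
  assumes "finite A" "\<And>i. i \<in> A \<Longrightarrow> abs_cont_on S (f i)"
  shows "abs_cont_on S (\<lambda>x. \<Sum>i\<in>A. f i x)"
  using assms by (induction A rule: finite_induct)
    (auto intro!: abs_cont_on_add intro: abs_cont_on_lipschitz[of 1])

lemma abs_cont_on_mult:
  assumes f: "abs_cont_on {a..b} f" and g: "abs_cont_on {a..b} g"
  shows "abs_cont_on {a..b} (\<lambda>x. f x * g x)"
proof -
  have "bounded (f ` {a..b})" "bounded (g ` {a..b})"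
    using f g by (auto intro!: compact_imp_bounded compact_continuous_image abs_cont_on_imp_continuous_on)
  then obtain K L where K: "\<And>x. x \<in> {a..b} \<Longrightarrow> \<bar>f x\<bar> \<le> K" and L: "\<And>x. x \<in> {a..b} \<Longrightarrow> \<bar>g x\<bar> \<le> L"
    unfolding bounded_iff by (force simp del: atLeastAtMost_iff)
  define M where "M = max 1 (max K L)"
  show ?thesis
  proof (rule abs_cont_on_dominated[OF f g, of M])
    fix x y assume xy: "x \<in> {a..b}" "y \<in> {a..b}"
    have "f y * g y - f x * g x = g y * (f y - f x) + f x * (g y - g x)"
      by (simp add: algebra_simps)
    also have "\<bar>\<dots>\<bar> \<le> \<bar>g y\<bar> * \<bar>f y - f x\<bar> + \<bar>f x\<bar> * \<bar>g y - g x\<bar>"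
      by (simp add: abs_mult[symmetric] abs_triangle_ineq)
    also have "\<dots> \<le> M * \<bar>f y - f x\<bar> + M * \<bar>g y - g x\<bar>"
      using K[OF xy(1)] L[OF xy(2)] by (intro add_mono mult_right_mono) (auto simp: M_def)
    finally show "\<bar>f y * g y - f x * g x\<bar> \<le> M * \<bar>f y - f x\<bar> + M * \<bar>g y - g x\<bar>" .
  qed (auto simp: M_def)
qed

text \<open>The continuous derivative is bounded on the compact interval, so \<open>f\<close> is
  Lipschitz; \<open>max K 1\<close> supplies a strictly positive constant.\<close>

lemma abs_cont_on_C1:
  assumes d: "\<And>x. x \<in> {a..b} \<Longrightarrow> (f has_vector_derivative f' x) (at x within {a..b})"
    and c: "continuous_on {a..b} f'"
  shows "abs_cont_on {a..b} f"
proof -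
  have "bounded (f' ` {a..b})"
    using c by (auto intro!: compact_imp_bounded compact_continuous_image)
  then obtain K where K: "\<And>x. x \<in> {a..b} \<Longrightarrow> \<bar>f' x\<bar> \<le> K"
    unfolding bounded_iff by (force simp del: atLeastAtMost_iff)
  show ?thesis
  proof (rule abs_cont_on_lipschitz[of "max K 1"])
    fix x y assume xy: "x \<in> {a..b}" "y \<in> {a..b}"
    show "\<bar>f y - f x\<bar> \<le> max K 1 * \<bar>y - x\<bar>"
      using field_differentiable_bound[of "{a..b}" f f' "max K 1" y x] d K xy
      by (force simp: has_real_derivative_iff_has_vector_derivative)
  qed auto
qed

subsection \<open>Chains of derivatives\<close>

text \<open>Here \<open>U j\<close> plays the role of the derivative of order \<open>j\<close>; \<open>U n\<close> matters only almost everywhere.\<close>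

definition ac_chain :: "real \<Rightarrow> real \<Rightarrow> nat \<Rightarrow> (nat \<Rightarrow> real \<Rightarrow> real) \<Rightarrow> bool" where
  "ac_chain a b n U \<longleftrightarrow> (\<forall>j<n. abs_cont_on {a..b} (U j) \<and>
     (\<exists>N. negligible N \<and> (\<forall>x\<in>{a..b} - N. (U j has_vector_derivative U (Suc j) x) (at x within {a..b}))))"

lemma ac_chain_abs_cont: "ac_chain a b n U \<Longrightarrow> j < n \<Longrightarrow> abs_cont_on {a..b} (U j)"
  by (simp add: ac_chain_def)

lemma ac_chain_continuous_on: "ac_chain a b n U \<Longrightarrow> j < n \<Longrightarrow> continuous_on {a..b} (U j)"
  by (intro abs_cont_on_imp_continuous_on ac_chain_abs_cont)

lemma ac_chain_negligible:
  assumes "ac_chain a b n U"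
  obtains N where "negligible N"
    "\<And>j x. j < n \<Longrightarrow> x \<in> {a..b} - N \<Longrightarrow> (U j has_vector_derivative U (Suc j) x) (at x within {a..b})"
proof -
  obtain N where N: "\<And>j. j < n \<Longrightarrow> negligible (N j)"
    "\<And>j x. j < n \<Longrightarrow> x \<in> {a..b} - N j \<Longrightarrow> (U j has_vector_derivative U (Suc j) x) (at x within {a..b})"
    using assms unfolding ac_chain_def by metis
  show thesis
    using N by (intro that[of "\<Union>j<n. N j"] negligible_Union) auto
qed

lemma ac_chain_subset:
  assumes U: "ac_chain a b n U" and s: "{a'..b'} \<subseteq> {a..b}" and mn: "m \<le> n"
  shows "ac_chain a' b' m U"
proof -
  obtain N where N: "negligible N"
    "\<And>j x. j < n \<Longrightarrow> x \<in> {a..b} - N \<Longrightarrow> (U j has_vector_derivative U (Suc j) x) (at x within {a..b})"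
    using ac_chain_negligible[OF U] by blast
  have "(U j has_vector_derivative U (Suc j) x) (at x within {a'..b'})" if "j < m" "x \<in> {a'..b'} - N" for j x
    using has_vector_derivative_within_subset[OF N(2) s] that s mn by auto
  then show ?thesis
    unfolding ac_chain_def using N(1) abs_cont_on_subset[OF ac_chain_abs_cont[OF U] s] mn
    by (metis order_less_le_trans)
qed

lemma ac_chain_shift: "ac_chain a b (m + n) U \<Longrightarrow> ac_chain a b n (\<lambda>j. U (m + j))"
  unfolding ac_chain_def by auto

lemma ac_chain_diff:
  assumes U: "ac_chain a b n U" and V: "ac_chain a b n V"
  shows "ac_chain a b n (\<lambda>j x. U j x - V j x)"
proof -
  obtain N where N: "negligible N"
    "\<And>j x. j < n \<Longrightarrow> x \<in> {a..b} - N \<Longrightarrow> (U j has_vector_derivative U (Suc j) x) (at x within {a..b})"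
    using ac_chain_negligible[OF U] by blast
  obtain M where M: "negligible M"
    "\<And>j x. j < n \<Longrightarrow> x \<in> {a..b} - M \<Longrightarrow> (V j has_vector_derivative V (Suc j) x) (at x within {a..b})"
    using ac_chain_negligible[OF V] by blast
  have "abs_cont_on {a..b} (\<lambda>x. U j x - V j x)" if "j < n" for j
    by (rule abs_cont_on_dominated[OF ac_chain_abs_cont[OF U that] ac_chain_abs_cont[OF V that], of 1]) auto
  moreover have "((\<lambda>x. U j x - V j x) has_vector_derivative U (Suc j) x - V (Suc j) x) (at x within {a..b})"
    if "j < n" "x \<in> {a..b} - (N \<union> M)" for j x
    using that by (intro has_vector_derivative_diff N M) auto
  ultimately show ?thesis
    unfolding ac_chain_def using negligible_Un[OF N(1) M(1)] by blast
qed

text \<open>All \<open>n\<close> integrations by parts happen at once: the alternating sum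
  \<open>G\<close> of products is absolutely continuous, and almost everywhere its derivative
  telescopes to the integrand.\<close>

lemma telescoping_integration_by_parts:
  assumes ab: "a \<le> b" and V: "ac_chain a b n V" and U: "ac_chain a b n U"
  shows "((\<lambda>x. V n x * U 0 x - (-1)^n * (V 0 x * U n x)) has_integral
     (\<Sum>j<n. (-1)^j * (V (n - 1 - j) b * U j b)) - (\<Sum>j<n. (-1)^j * (V (n - 1 - j) a * U j a))) {a..b}"
proof -
  obtain N where N: "negligible N"
    "\<And>j x. j < n \<Longrightarrow> x \<in> {a..b} - N \<Longrightarrow> (U j has_vector_derivative U (Suc j) x) (at x within {a..b})"
    using ac_chain_negligible[OF U] by blast
  obtain M where M: "negligible M"
    "\<And>j x. j < n \<Longrightarrow> x \<in> {a..b} - M \<Longrightarrow> (V j has_vector_derivative V (Suc j) x) (at x within {a..b})"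
    using ac_chain_negligible[OF V] by blast
  define G where "G x = (\<Sum>j<n. (-1)^j * (V (n - 1 - j) x * U j x))" for x
  have ac: "abs_cont_on {a..b} G"
    unfolding G_def
    by (intro abs_cont_on_sum abs_cont_on_mult ac_chain_abs_cont[OF V] ac_chain_abs_cont[OF U])
      (auto intro: abs_cont_on_lipschitz[of 1])
  \<comment> \<open>Only \<open>m = n\<close> is used; partial sums are needed for the induction,
    where the bound \<open>m \<le> n\<close> keeps the truncated subtractions honest.\<close>
  have tele: "(\<Sum>j<m. (-1)^j * (V (n - j) x * U j x + V (n - 1 - j) x * U (Suc j) x))
     = V n x * U 0 x - (-1)^m * (V (n - m) x * U m x)" if "m \<le> n" for m x
    using that by (induction m) (auto simp: algebra_simps Suc_diff_Suc)
  have der: "(G has_vector_derivative V n x * U 0 x - (-1)^n * (V 0 x * U n x)) (at x within {a..b})"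
    if x: "x \<in> {a..b} - (N \<union> M)" for x
  proof -
    have "((\<lambda>x. (-1)^j * (V (n - 1 - j) x * U j x)) has_real_derivative
       (-1)^j * (V (n - j) x * U j x + V (n - 1 - j) x * U (Suc j) x)) (at x within {a..b})"
      if "j \<in> {..<n}" for j
    proof -
      have 1: "(V (n - 1 - j) has_real_derivative V (n - j) x) (at x within {a..b})"
        using M(2)[of "n - 1 - j" x] x that by (simp add: has_real_derivative_iff_has_vector_derivative Suc_diff_Suc)
      have 2: "(U j has_real_derivative U (Suc j) x) (at x within {a..b})"
        using N(2)[of j x] x that by (simp add: has_real_derivative_iff_has_vector_derivative)
      show ?thesis
        by (rule DERIV_cmult[OF DERIV_cong[OF DERIV_mult[OF 1 2]]]) simp
    qed
    then have "(G has_real_derivative (\<Sum>j<n. (-1)^j * (V (n - j) x * U j x + V (n - 1 - j) x * U (Suc j) x)))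
        (at x within {a..b})"
      unfolding G_def by (intro DERIV_sum) auto
    then show ?thesis
      using tele[of n x] by (simp add: has_real_derivative_iff_has_vector_derivative)
  qed
  show ?thesis
    using abs_cont_fundamental_theorem_of_calculus[OF ab ac negligible_Un[OF N(1) M(1)] der]
    by (simp add: G_def)
qed

text \<open>Asking for derivatives on the whole line lets chains be rescaled freely without leaving
  their domain.\<close>

definition smooth_chain :: "(nat \<Rightarrow> real \<Rightarrow> real) \<Rightarrow> bool" where
  "smooth_chain U \<longleftrightarrow> (\<forall>j x. (U j has_real_derivative U (Suc j) x) (at x))"

lemma smooth_chain_DERIV:
  "smooth_chain U \<Longrightarrow> (U j has_real_derivative U (Suc j) x) (at x within S)"
  unfolding smooth_chain_def by (meson has_field_derivative_at_within)

lemma smooth_chain_continuous_on: "smooth_chain U \<Longrightarrow> continuous_on S (U j)"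
  by (meson DERIV_continuous_on smooth_chain_DERIV)

lemma smooth_chain_shift: "smooth_chain U \<Longrightarrow> smooth_chain (\<lambda>j. U (m + j))"
  by (simp add: smooth_chain_def)

lemma smooth_chain_lincomb:
  assumes "smooth_chain U" "smooth_chain V"
  shows "smooth_chain (\<lambda>j x. c * U j x + d * V j x)"
  unfolding smooth_chain_def
  by (intro allI DERIV_add DERIV_cmult smooth_chain_DERIV assms)

lemma smooth_chain_ac_chain:
  assumes "smooth_chain U"
  shows "ac_chain a b n U"
proof -
  have d: "(U j has_vector_derivative U (Suc j) x) (at x within {a..b})" for j x
    using smooth_chain_DERIV[OF assms] by (simp add: has_real_derivative_iff_has_vector_derivative)
  show ?thesis
    unfolding ac_chain_def
    using abs_cont_on_C1[OF d smooth_chain_continuous_on[OF assms]] d negligible_empty by blast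
qed

section \<open>Derivatives relative to the interval and their chains\<close>

lemma deriv_I_0 [simp]: "deriv_I 0 f = f"
  by (simp add: deriv_I_def)

lemma deriv_I_Suc: "deriv_I (Suc j) f x = vector_derivative (deriv_I j f) (at x within \<I>)"
  by (simp add: deriv_I_def)

lemma AE_lebesgue_on_negligible:
  assumes "AE x in lebesgue_on S. P x" "S \<in> sets lebesgue"
  obtains N where "negligible N" "\<And>x. x \<in> S - N \<Longrightarrow> P x"
proof -
  have "AE x in lebesgue. x \<in> S \<longrightarrow> P x"
    using assms by (simp add: AE_restrict_space_iff)
  then obtain N where "N \<in> null_sets lebesgue" "{x \<in> space lebesgue. \<not> (x \<in> S \<longrightarrow> P x)} \<subseteq> N"
    by (auto simp: eventually_ae_filter)
  then show thesis
    using that[of N] by (auto simp: negligible_iff_null_sets)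
qed

text \<open>Below order \<open>r - 1\<close> the derivative exists everywhere and is continuous,
  being itself differentiable or, at the last order, absolutely continuous; hence these orders are
  of class C1. Order \<open>r - 1\<close> is covered by the definition of the space.\<close>

lemma L2_space_ac_chain:
  assumes f: "f \<in> L2_space r" and r: "r \<ge> 1"
  shows "ac_chain (-1) 1 r (\<lambda>j. deriv_I j f)"
proof -
  have dif: "\<And>j x. j < r - 1 \<Longrightarrow> x \<in> \<I> \<Longrightarrow> deriv_I j f differentiable (at x within \<I>)"
    and ac: "abs_cont_on \<I> (deriv_I (r - 1) f)"
    and ae: "AE x in lebesgue_on \<I>. deriv_I (r - 1) f differentiable (at x within \<I>)"
    using f unfolding L2_space_def by auto
  have hd: "(deriv_I j f has_vector_derivative deriv_I (Suc j) f x) (at x within \<I>)"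
    if "deriv_I j f differentiable (at x within \<I>)" for j x
    using that by (simp add: deriv_I_Suc vector_derivative_works)
  have cont: "continuous_on \<I> (deriv_I j f)" if "j < r" for j
  proof (cases "j = r - 1")
    case True
    then show ?thesis using abs_cont_on_imp_continuous_on[OF ac] by simp
  next
    case False
    then show ?thesis
      using that dif[of j]
      by (auto simp: continuous_on_eq_continuous_within simp del: atLeastAtMost_iff intro: differentiable_imp_continuous_within)
  qed
  obtain N where N: "negligible N" "\<And>x. x \<in> \<I> - N \<Longrightarrow> deriv_I (r - 1) f differentiable (at x within \<I>)"
    using AE_lebesgue_on_negligible[OF ae] by auto
  show ?thesis
    unfolding ac_chain_def
  proof (intro allI impI)
    fix j assume j: "j < r"
    show "abs_cont_on \<I> (deriv_I j f) \<and> (\<exists>N. negligible N \<and>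
       (\<forall>x\<in>\<I> - N. (deriv_I j f has_vector_derivative deriv_I (Suc j) f x) (at x within \<I>)))"
    proof (cases "j = r - 1")
      case True
      then show ?thesis using ac N hd by blast
    next
      case False
      then have "j < r - 1" "Suc j < r" using j by auto
      then show ?thesis
        using abs_cont_on_C1[OF hd[OF dif] cont] hd dif negligible_empty by (metis DiffD1)
    qed
  qed
qed

text \<open>Induction on the order: the derivative within \<I> depends only on values in \<I>, where
  the restriction agrees with the chain, and it is unique since the interval is
  non-degenerate.\<close>

lemma smooth_chain_deriv_I:
  assumes U: "smooth_chain U" and x: "x \<in> \<I>"
  shows "deriv_I j (restrict (U 0) \<I>) x = U j x"
    and "(deriv_I j (restrict (U 0) \<I>) has_vector_derivative U (Suc j) x) (at x within \<I>)"
proof -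
  define F where "F = restrict (U 0) \<I>"
  note D = smooth_chain_DERIV[OF U, of _ _ \<I>, unfolded has_real_derivative_iff_has_vector_derivative]
  have eq: "\<forall>x\<in>\<I>. deriv_I j F x = U j x" for j
  proof (induction j)
    case 0
    show ?case by (simp add: F_def)
  next
    case (Suc j)
    show ?case
    proof
      fix x assume x: "x \<in> \<I>"
      have "(deriv_I j F has_vector_derivative U (Suc j) x) (at x within \<I>)"
        using Suc by (intro has_vector_derivative_transform[OF x _ D]) simp
      then show "deriv_I (Suc j) F x = U (Suc j) x"
        unfolding deriv_I_Suc by (intro vector_derivative_within_closed_interval[OF _ x]) simp
    qed
  qed
  show "deriv_I j (restrict (U 0) \<I>) x = U j x"
    using eq x by (simp add: F_def)
  show "(deriv_I j (restrict (U 0) \<I>) has_vector_derivative U (Suc j) x) (at x within \<I>)"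
    using eq by (intro has_vector_derivative_transform[OF x _ D]) (simp add: F_def)
qed

subsection \<open>The inner product of square-integrable functions\<close>

definition ip :: "(real \<Rightarrow> real) \<Rightarrow> (real \<Rightarrow> real) \<Rightarrow> real" where
  "ip f g = (\<integral>x. f x * g x \<partial>lebesgue_on \<I>)"

lemma L2_cong: "(\<And>x. x \<in> \<I> \<Longrightarrow> f x = g x) \<Longrightarrow> f \<in> L2 \<longleftrightarrow> g \<in> L2"
  unfolding L2_def mem_Collect_eq
  by (intro conj_cong measurable_cong Bochner_Integration.integrable_cong) (auto simp: space_restrict_space)

lemma norm2_cong: "(\<And>x. x \<in> \<I> \<Longrightarrow> f x = g x) \<Longrightarrow> norm2 f = norm2 g"
  unfolding norm2_def
  by (intro arg_cong[of _ _ sqrt] Bochner_Integration.integral_cong) (auto simp: space_restrict_space)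

lemma continuous_on_L2: "continuous_on \<I> f \<Longrightarrow> f \<in> L2"
  unfolding L2_def
  by (auto intro!: continuous_imp_measurable_on_sets_lebesgue continuous_imp_integrable_real continuous_intros)

lemma L2_mult_integrable:
  assumes "f \<in> L2" "g \<in> L2"
  shows "integrable (lebesgue_on \<I>) (\<lambda>x. f x * g x)"
proof (rule Bochner_Integration.integrable_bound[where f = "\<lambda>x. (f x)\<^sup>2 + (g x)\<^sup>2"])
  show "AE x in lebesgue_on \<I>. norm (f x * g x) \<le> norm ((f x)\<^sup>2 + (g x)\<^sup>2)"
  proof (intro AE_I2)
    fix x
    have "2 * \<bar>f x\<bar> * \<bar>g x\<bar> \<le> \<bar>f x\<bar>\<^sup>2 + \<bar>g x\<bar>\<^sup>2" by (rule sum_squares_bound)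
    moreover have "0 \<le> \<bar>f x\<bar> * \<bar>g x\<bar>" by simp
    ultimately have "\<bar>f x\<bar> * \<bar>g x\<bar> \<le> (f x)\<^sup>2 + (g x)\<^sup>2"
      unfolding power2_abs mult.assoc by linarith
    then show "norm (f x * g x) \<le> norm ((f x)\<^sup>2 + (g x)\<^sup>2)" by (simp add: abs_mult)
  qed
qed (use assms in \<open>auto simp: L2_def\<close>)

lemma ip_eq_integral:
  assumes "f \<in> L2" "g \<in> L2"
  shows "(\<lambda>x. f x * g x) integrable_on \<I>" "ip f g = integral \<I> (\<lambda>x. f x * g x)"
proof -
  show "ip f g = integral \<I> (\<lambda>x. f x * g x)"
    unfolding ip_def by (intro lebesgue_integral_eq_integral L2_mult_integrable assms) auto
  show "(\<lambda>x. f x * g x) integrable_on \<I>"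
    using L2_mult_integrable[OF assms] by (intro integrable_on_lebesgue_on) auto
qed

lemma L2_lincomb:
  assumes "f \<in> L2" "g \<in> L2"
  shows "(\<lambda>x. c * f x + d * g x) \<in> L2"
proof -
  have "integrable (lebesgue_on \<I>) (\<lambda>x. c\<^sup>2 * (f x * f x) + 2 * c * d * (f x * g x) + d\<^sup>2 * (g x * g x))"
    by (intro Bochner_Integration.integrable_add integrable_mult_right L2_mult_integrable assms)
  then have "integrable (lebesgue_on \<I>) (\<lambda>x. (c * f x + d * g x)\<^sup>2)"
    by (simp add: power2_eq_square algebra_simps)
  then show ?thesis using assms by (auto simp: L2_def)
qed

lemma ip_commute: "ip f g = ip g f"
  by (simp add: ip_def mult.commute)

lemma ip_lincomb:
  assumes "f \<in> L2" "g \<in> L2" "h \<in> L2"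
  shows "ip (\<lambda>x. c * f x + d * g x) h = c * ip f h + d * ip g h"
proof -
  have "ip (\<lambda>x. c * f x + d * g x) h = (\<integral>x. c * (f x * h x) + d * (g x * h x) \<partial>lebesgue_on \<I>)"
    by (simp add: ip_def algebra_simps)
  also have "\<dots> = c * ip f h + d * ip g h"
    using assms by (subst Bochner_Integration.integral_add) (auto simp: ip_def intro!: L2_mult_integrable)
  finally show ?thesis .
qed

lemma norm2_nonneg [simp]: "norm2 f \<ge> 0"
  by (simp add: norm2_def)

lemma norm2_square: "(norm2 f)\<^sup>2 = ip f f"
  by (simp add: norm2_def ip_def power2_eq_square flip: abs_mult)

lemma norm2_lincomb_square:
  assumes "f \<in> L2" "g \<in> L2"
  shows "(norm2 (\<lambda>x. c * f x + d * g x))\<^sup>2 = c\<^sup>2 * (norm2 f)\<^sup>2 + 2 * c * d * ip f g + d\<^sup>2 * (norm2 g)\<^sup>2"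
proof -
  define h where "h = (\<lambda>x. c * f x + d * g x)"
  have h: "h \<in> L2" unfolding h_def by (intro L2_lincomb assms)
  have "ip h h = c * ip h f + d * ip h g"
    using ip_lincomb[OF assms h, of c d] unfolding h_def[symmetric]
    by (simp only: ip_commute[of f h] ip_commute[of g h])
  moreover have "ip h f = c * ip f f + d * ip f g"
    using ip_lincomb[OF assms assms(1), of c d] unfolding h_def[symmetric]
    by (simp only: ip_commute[of g f])
  moreover have "ip h g = c * ip f g + d * ip g g"
    using ip_lincomb[OF assms assms(2), of c d] unfolding h_def[symmetric] .
  ultimately show ?thesis
    unfolding norm2_square h_def[symmetric] by (simp add: power2_eq_square algebra_simps)
qed

lemma norm2_cmult: "norm2 (\<lambda>x. c * f x) = \<bar>c\<bar> * norm2 f"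
  by (simp add: norm2_def power_mult_distrib real_sqrt_mult)

text \<open>Elements of \<open>L2\<close> are functions rather than classes, so \<open>norm2\<close>
  is only a seminorm. The proof therefore uses nothing but non-negativity of the quadratic form in
  \<open>c\<close> and \<open>d\<close>.\<close>

lemma ip_Cauchy_Schwarz:
  assumes "f \<in> L2" "g \<in> L2"
  shows "\<bar>ip f g\<bar> \<le> norm2 f * norm2 g"
proof -
  have *: "0 \<le> c\<^sup>2 * (norm2 f)\<^sup>2 + 2 * c * d * ip f g + d\<^sup>2 * (norm2 g)\<^sup>2" for c d
    using norm2_lincomb_square[OF assms, of c d] by (metis zero_le_power2)
  have "(ip f g)\<^sup>2 \<le> (norm2 f)\<^sup>2 * (norm2 g)\<^sup>2"
  proof (cases "norm2 g = 0")
    case True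
    have "ip f g = 0"
    proof (rule ccontr)
      assume "ip f g \<noteq> 0"
      \<comment> \<open>These coefficients give the quadratic form the value -1.\<close>
      then show False
        using *[of 1 "- ((norm2 f)\<^sup>2 + 1) / (2 * ip f g)"] True by (simp add: field_simps)
    qed
    then show ?thesis by simp
  next
    case False
    have "0 \<le> (norm2 g)\<^sup>2 * ((norm2 f)\<^sup>2 * (norm2 g)\<^sup>2 - (ip f g)\<^sup>2)"
      using *[of "(norm2 g)\<^sup>2" "- ip f g"] by (simp add: power2_eq_square algebra_simps)
    then show ?thesis
      using False by (simp add: zero_le_mult_iff)
  qed
  then have "\<bar>ip f g\<bar>\<^sup>2 \<le> (norm2 f * norm2 g)\<^sup>2" by (simp add: power_mult_distrib)
  then show ?thesis by (rule power2_le_imp_le) simp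
qed

lemma norm2_diff_le:
  assumes "f \<in> L2" "g \<in> L2"
  shows "\<bar>norm2 f - norm2 g\<bar> \<le> norm2 (\<lambda>x. f x - g x)"
proof (rule power2_le_imp_le)
  have "ip f g \<le> norm2 f * norm2 g" using ip_Cauchy_Schwarz[OF assms] by simp
  then show "\<bar>norm2 f - norm2 g\<bar>\<^sup>2 \<le> (norm2 (\<lambda>x. f x - g x))\<^sup>2"
    using norm2_lincomb_square[OF assms, of 1 "-1"] by (simp add: power2_diff)
qed simp

section \<open>Membership of smooth functions in the function spaces\<close>

lemma smooth_chain_L2: "smooth_chain U \<Longrightarrow> U j \<in> L2"
  by (intro continuous_on_L2 smooth_chain_continuous_on)

lemma smooth_chain_L2_space:
  assumes U: "smooth_chain U"
  shows "restrict (U 0) \<I> \<in> L2_space m"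
proof -
  note d = smooth_chain_deriv_I[OF U]
  have dif: "deriv_I j (restrict (U 0) \<I>) differentiable (at x within \<I>)" if "x \<in> \<I>" for j x
    using d(2)[OF that] by (rule differentiableI_vector)
  have "abs_cont_on \<I> (deriv_I (m - 1) (restrict (U 0) \<I>))"
    by (rule abs_cont_on_C1[OF d(2) smooth_chain_continuous_on[OF U]])
  moreover have "deriv_I m (restrict (U 0) \<I>) \<in> L2"
    using smooth_chain_L2[OF U, of m] L2_cong[of "deriv_I m (restrict (U 0) \<I>)" "U m"] d(1) by blast
  moreover have "AE x in lebesgue_on \<I>. deriv_I (m - 1) (restrict (U 0) \<I>) differentiable (at x within \<I>)"
    by (intro AE_I2 dif) (simp add: space_restrict_space)
  ultimately show ?thesis
    unfolding L2_space_def using dif by blast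
qed

lemma L2_space_L2:
  assumes "f \<in> L2_space r" "r \<ge> 1"
  shows "f \<in> L2" "deriv_I r f \<in> L2"
proof -
  show "f \<in> L2"
    using ac_chain_continuous_on[OF L2_space_ac_chain[OF assms], of 0] assms(2) by (auto intro: continuous_on_L2)
  show "deriv_I r f \<in> L2" using assms(1) by (simp add: L2_space_def)
qed

subsection \<open>Linear systems\<close>

text \<open>Gaussian elimination, by induction on the equations: if equation \<open>e\<close> has a
  nonzero coefficient at \<open>y\<close>, it is used to eliminate \<open>y\<close> from the others
  and afterwards determines the value at \<open>y\<close>.\<close>

lemma homogeneous_system_nontrivial_solution:
  fixes M :: "'e \<Rightarrow> 'x \<Rightarrow> 'a::field"
  assumes "finite E" "finite X" "card E < card X"
  shows "\<exists>c. (\<exists>x\<in>X. c x \<noteq> 0) \<and> (\<forall>e\<in>E. (\<Sum>x\<in>X. M e x * c x) = 0)"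
  using assms
proof (induction E arbitrary: X M rule: finite_induct)
  case empty
  then obtain x where "x \<in> X" by fastforce
  then show ?case by (intro exI[of _ "\<lambda>_. 1"]) auto
next
  case (insert e E)
  show ?case
  proof (cases "\<forall>x\<in>X. M e x = 0")
    case True
    obtain c where "\<exists>x\<in>X. c x \<noteq> 0" "\<forall>e\<in>E. (\<Sum>x\<in>X. M e x * c x) = 0"
      using insert.IH[of X M] insert.prems insert.hyps by (metis Suc_lessD card_insert_disjoint)
    then show ?thesis using True by (intro exI[of _ c]) auto
  next
    case False
    then obtain y where y: "y \<in> X" "M e y \<noteq> 0" by blast
    define X' where "X' = X - {y}"
    have X': "finite X'" "y \<notin> X'" "X = insert y X'" "card E < card X'"
      using insert.prems insert.hyps y by (auto simp: X'_def)
    obtain c where c: "\<exists>x\<in>X'. c x \<noteq> 0"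
      "\<And>f. f \<in> E \<Longrightarrow> (\<Sum>x\<in>X'. (M f x - M f y / M e y * M e x) * c x) = 0"
      using insert.IH[OF X'(1,4), of "\<lambda>f x. M f x - M f y / M e y * M e x"] by blast
    define d where "d = c(y := - (\<Sum>x\<in>X'. M e x * c x) / M e y)"
    have dsum: "(\<Sum>x\<in>X. M f x * d x) = (\<Sum>x\<in>X'. M f x * c x) - M f y / M e y * (\<Sum>x\<in>X'. M e x * c x)" for f
    proof -
      have "(\<Sum>x\<in>X'. M f x * d x) = (\<Sum>x\<in>X'. M f x * c x)"
        using X'(2) by (intro sum.cong) (auto simp: d_def)
      then show ?thesis using X'(1,2) unfolding X'(3) by (simp add: d_def)
    qed
    have "(\<Sum>x\<in>X. M f x * d x) = 0" if "f \<in> E" for f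
      using c(2)[OF that] unfolding dsum by (simp add: algebra_simps sum_subtractf sum_distrib_left)
    moreover have "(\<Sum>x\<in>X. M e x * d x) = 0"
      unfolding dsum using y by simp
    moreover have "\<exists>x\<in>X. d x \<noteq> 0"
      using c(1) X'(2,3) by (auto simp: d_def)
    ultimately show ?thesis by (intro exI[of _ d]) simp
  qed
qed

text \<open>The right-hand side becomes an additional column \<open>n\<close>, so a nontrivial
  solution of the enlarged homogeneous system exists. Injectivity forces its last coordinate to be
  nonzero, and dividing by it solves the system. This turns uniqueness for the boundary value
  problem into existence.\<close>

lemma injective_system_solvable:
  fixes M :: "nat \<Rightarrow> nat \<Rightarrow> 'a::field"
  assumes inj: "\<And>c. \<forall>i<n. (\<Sum>j<n. M i j * c j) = 0 \<Longrightarrow> \<forall>j<n. c j = 0"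
  shows "\<exists>c. \<forall>i<n. (\<Sum>j<n. M i j * c j) = b i"
proof -
  define M' where "M' i j = (if j = n then - b i else M i j)" for i j
  obtain c where c: "\<exists>j\<in>{..n}. c j \<noteq> 0" "\<forall>i\<in>{..<n}. (\<Sum>j\<in>{..n}. M' i j * c j) = 0"
    using homogeneous_system_nontrivial_solution[of "{..<n}" "{..n}" M', OF finite_lessThan finite_atMost]
    by (simp only: card_lessThan card_atMost lessI simp_thms) blast
  have eq: "(\<Sum>j<n. M i j * c j) = b i * c n" if "i < n" for i
  proof -
    have "(\<Sum>j\<in>{..n}. M' i j * c j) = (\<Sum>j<n. M' i j * c j) - b i * c n"
      unfolding lessThan_Suc_atMost[symmetric] sum.lessThan_Suc by (simp add: M'_def[of _ n])
    also have "(\<Sum>j<n. M' i j * c j) = (\<Sum>j<n. M i j * c j)"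
      by (intro sum.cong) (auto simp: M'_def)
    finally show ?thesis using c(2) that by auto
  qed
  have "c n \<noteq> 0"
  proof
    assume "c n = 0"
    then have "\<forall>j<n. c j = 0" using eq by - (rule inj, simp)
    with \<open>c n = 0\<close> c(1) show False by (auto simp: le_less)
  qed
  then have "\<forall>i<n. (\<Sum>j<n. M i j * (c j / c n)) = b i"
    using eq unfolding times_divide_eq_right sum_divide_distrib[symmetric] by simp
  then show ?thesis by (intro exI[of _ "\<lambda>j. c j / c n"])
qed

subsection \<open>Functions given by exponential generating series\<close>

text \<open>Geometric growth makes the exponential generating series converge on the whole line and
  survives shifts of the index.\<close>

definition exp_type :: "(nat \<Rightarrow> real) \<Rightarrow> bool" where
  "exp_type a \<longleftrightarrow> (\<exists>K M. \<forall>i. \<bar>a i\<bar> \<le> K * M ^ i)"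

definition egf :: "(nat \<Rightarrow> real) \<Rightarrow> real \<Rightarrow> real" where
  "egf a t = (\<Sum>i. a i / fact i * t ^ i)"

text \<open>Differentiating an exponential generating series shifts its coefficients. The centre is
  -1, so that \<open>a j\<close> is the derivative of order \<open>j\<close> at the end point
  carrying the inhomogeneous datum.\<close>

definition egf_chain :: "(nat \<Rightarrow> real) \<Rightarrow> nat \<Rightarrow> real \<Rightarrow> real" where
  "egf_chain a j x = egf (\<lambda>i. a (j + i)) (x + 1)"

lemma exp_type_shift: 
  assumes "exp_type a"
  shows "exp_type (\<lambda>i. a (j + i))"
proof -
  obtain K M where "\<And>i. \<bar>a i\<bar> \<le> K * M ^ i" using assms unfolding exp_type_def by blast
  then have "\<forall>i. \<bar>a (j + i)\<bar> \<le> (K * M ^ j) * M ^ i"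
    by (metis power_add mult.assoc)
  then show ?thesis unfolding exp_type_def by blast
qed

lemma exp_type_summable:
  assumes "exp_type a"
  shows "summable (\<lambda>i. a i / fact i * t ^ i)"
proof -
  obtain K M where KM: "\<And>i. \<bar>a i\<bar> \<le> K * M ^ i" using assms unfolding exp_type_def by blast
  show ?thesis
  proof (rule summable_comparison_test'[where N = 0])
    show "summable (\<lambda>i. K * (inverse (fact i) * (M * \<bar>t\<bar>) ^ i))"
      by (intro summable_mult summable_exp)
    fix i :: nat
    have "\<bar>a i\<bar> * (\<bar>t\<bar> ^ i / fact i) \<le> K * M ^ i * (\<bar>t\<bar> ^ i / fact i)"
      by (intro mult_right_mono KM) simp
    then show "norm (a i / fact i * t ^ i) \<le> K * (inverse (fact i) * (M * \<bar>t\<bar>) ^ i)"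
      by (simp add: abs_mult power_abs power_mult_distrib divide_inverse algebra_simps)
  qed
qed

lemma egf_DERIV:
  assumes "exp_type a"
  shows "(egf a has_real_derivative egf (\<lambda>i. a (Suc i)) t) (at t)"
proof -
  have "((\<lambda>x. \<Sum>i. a i / fact i * x ^ i) has_real_derivative (\<Sum>i. diffs (\<lambda>i. a i / fact i) i * t ^ i)) (at t)"
    by (intro termdiffs_strong_converges_everywhere exp_type_summable assms)
  moreover have "diffs (\<lambda>i. a i / fact i) i = a (Suc i) / fact i" for i
    by (simp add: diffs_def fact_Suc del: of_nat_Suc)
  ultimately show ?thesis by (simp add: egf_def[abs_def])
qed

lemma smooth_chain_egf:
  assumes "exp_type a"
  shows "smooth_chain (egf_chain a)"
  unfolding smooth_chain_def
proof (intro allI)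
  fix j x
  have "(egf (\<lambda>i. a (j + i)) has_real_derivative egf (\<lambda>i. a (Suc j + i)) (x + 1)) (at (x + 1))"
    using egf_DERIV[OF exp_type_shift[OF assms], of j "x + 1"] by simp
  then show "(egf_chain a j has_real_derivative egf_chain a (Suc j) x) (at x)"
    unfolding egf_chain_def by (simp add: DERIV_shift)
qed

lemma egf_chain_minus_one: "egf_chain a j (-1) = a j"
  using powser_zero[of "\<lambda>i. a (j + i) / fact i"] by (simp add: egf_chain_def egf_def del: powser_zero)

lemma egf_chain_sum:
  assumes "finite A" "\<And>m. m \<in> A \<Longrightarrow> exp_type (e m)"
  shows "egf_chain (\<lambda>i. \<Sum>m\<in>A. c m * e m i) j x = (\<Sum>m\<in>A. c m * egf_chain (e m) j x)"
proof -
  have "egf_chain (\<lambda>i. \<Sum>m\<in>A. c m * e m i) j x = (\<Sum>i. \<Sum>m\<in>A. c m * (e m (j + i) / fact i * (x + 1) ^ i))"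
    unfolding egf_chain_def egf_def by (simp add: sum_divide_distrib sum_distrib_right mult.assoc)
  also have "\<dots> = (\<Sum>m\<in>A. \<Sum>i. c m * (e m (j + i) / fact i * (x + 1) ^ i))"
    using assms by (intro suminf_sum summable_mult exp_type_summable[OF exp_type_shift]) auto
  also have "\<dots> = (\<Sum>m\<in>A. c m * egf_chain (e m) j x)"
    unfolding egf_chain_def egf_def
    using assms by (intro sum.cong refl suminf_mult exp_type_summable[OF exp_type_shift]) auto
  finally show ?thesis .
qed

lemma egf_cmult: "exp_type a \<Longrightarrow> egf (\<lambda>i. c * a i) t = c * egf a t"
  unfolding egf_def by (subst suminf_mult[symmetric, OF exp_type_summable]) (auto simp: mult.assoc)

lemma exp_type_sum:
  assumes "\<And>m i. m \<in> A \<Longrightarrow> \<bar>e m i\<bar> \<le> M ^ i"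
  shows "exp_type (\<lambda>i. \<Sum>m\<in>A. c m * e m i)"
  unfolding exp_type_def
proof (intro exI allI)
  fix i
  have "\<bar>\<Sum>m\<in>A. c m * e m i\<bar> \<le> (\<Sum>m\<in>A. \<bar>c m\<bar> * M ^ i)"
    using assms by (intro order_trans[OF sum_abs sum_mono]) (simp add: abs_mult mult_left_mono)
  then show "\<bar>\<Sum>m\<in>A. c m * e m i\<bar> \<le> (\<Sum>m\<in>A. \<bar>c m\<bar>) * M ^ i"
    by (simp add: sum_distrib_right)
qed

subsection \<open>The energy identity\<close>

text \<open>Integration by parts of \<open>V\<close> against the derivatives of \<open>U\<close>
  from order \<open>r\<close> on, with the differential equation eliminating the top one. Free
  choice of \<open>V\<close> and of the interval lets it serve uniqueness, orthogonality and
  minimality alike; \<open>N\<close> allows for an equation that may fail at the end points.\<close>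

lemma energy_identity:
  assumes ab: "a \<le> b" and V: "ac_chain a b r V" and U: "ac_chain a b (r + r) U"
    and N: "negligible N"
    and eq: "\<And>x. x \<in> {a..b} - N \<Longrightarrow> (-1) ^ r * U (r + r) x + lam * U 0 x = 0"
  shows "((\<lambda>x. V r x * U r x + lam * (V 0 x * U 0 x)) has_integral
     (\<Sum>j<r. (-1)^j * (V (r - 1 - j) b * U (r + j) b)) - (\<Sum>j<r. (-1)^j * (V (r - 1 - j) a * U (r + j) a))) {a..b}"
proof (rule has_integral_spike[OF N])
  show "((\<lambda>x. V r x * U (r + 0) x - (-1)^r * (V 0 x * U (r + r) x)) has_integral
     (\<Sum>j<r. (-1)^j * (V (r - 1 - j) b * U (r + j) b)) - (\<Sum>j<r. (-1)^j * (V (r - 1 - j) a * U (r + j) a))) {a..b}"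
    by (rule telescoping_integration_by_parts[OF ab V ac_chain_shift[OF U]])
  fix x assume "x \<in> {a..b} - N"
  then have "V 0 x * ((-1) ^ r * U (r + r) x + lam * U 0 x) = 0" using eq by simp
  then show "V r x * U r x + lam * (V 0 x * U 0 x) = V r x * U (r + 0) x - (-1)^r * (V 0 x * U (r + r) x)"
    by (simp add: algebra_simps)
qed

text \<open>Downward induction: where the next derivative vanishes, the fundamental theorem makes
  \<open>W s\<close> constant, equal to its value 0 at \<open>a\<close>.\<close>

lemma ac_chain_zero_descend:
  assumes W: "ac_chain a b n W" and zero: "\<And>s. s < n \<Longrightarrow> W s a = 0"
    and top: "\<And>x. x \<in> {a..b} \<Longrightarrow> W n x = 0" and s: "s \<le> n" and x: "x \<in> {a..b}"
  shows "W s x = 0"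
  using s x
proof (induction s arbitrary: x rule: inc_induct)
  case base
  then show ?case using top by blast
next
  case (step s)
  obtain N where N: "negligible N"
    "\<And>j x. j < n \<Longrightarrow> x \<in> {a..b} - N \<Longrightarrow> (W j has_vector_derivative W (Suc j) x) (at x within {a..b})"
    using ac_chain_negligible[OF W] by blast
  have sub: "{a..x} \<subseteq> {a..b}" using step.prems by auto
  have "(W (Suc s) has_integral W s x - W s a) {a..x}"
  proof (rule abs_cont_fundamental_theorem_of_calculus[OF _ _ N(1)])
    show "a \<le> x" using step.prems by simp
    show "abs_cont_on {a..x} (W s)"
      using ac_chain_abs_cont[OF W] step.hyps by (intro abs_cont_on_subset[OF _ sub]) auto
    fix y assume "y \<in> {a..x} - N"
    then show "(W s has_vector_derivative W (Suc s) y) (at y within {a..x})"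
      using N(2)[of s y] step.hyps sub by (intro has_vector_derivative_within_subset[OF _ sub]) auto
  qed
  moreover have "(W (Suc s) has_integral 0) {a..x}"
    using step.IH sub by (intro has_integral_is_0) auto
  ultimately have "W s x - W s a = 0" by (rule has_integral_unique)
  then show ?case using zero step.hyps by simp
qed

text \<open>Pairing \<open>W\<close> with itself leaves a continuous non-negative integrand of
  integral zero. Only \<open>W r = 0\<close> is extracted, because \<open>lam\<close> may be 0; the
  zero data at -1 then bring this down to order 0.\<close>

lemma energy_uniqueness:
  assumes r: "r \<ge> 1" and lam: "lam \<ge> 0" and W: "ac_chain (-1) 1 (r + r) W"
    and N: "negligible N"
    and eq: "\<And>x. x \<in> \<I> - N \<Longrightarrow> (-1) ^ r * W (r + r) x + lam * W 0 x = 0"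
    and bdy: "\<And>s. s < r \<Longrightarrow> W s (-1) = 0" "\<And>s. s < r \<Longrightarrow> W s 1 = 0"
    and x: "x \<in> \<I>"
  shows "W 0 x = 0"
proof -
  have Wr: "ac_chain (-1) 1 r W" by (rule ac_chain_subset[OF W]) auto
  have "((\<lambda>x. W r x * W r x + lam * (W 0 x * W 0 x)) has_integral 0) \<I>"
    using energy_identity[OF _ Wr W N eq] bdy by simp
  moreover have "continuous_on \<I> (\<lambda>x. W r x * W r x + lam * (W 0 x * W 0 x))"
    using r by (intro continuous_intros ac_chain_continuous_on[OF W]) auto
  ultimately have "W r y * W r y + lam * (W 0 y * W 0 y) = 0" if "y \<in> \<I>" for y
    using has_integral_0_cbox_imp_0[of "-1" 1 "\<lambda>x. W r x * W r x + lam * (W 0 x * W 0 x)" y] lam that by simp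
  then have "W r y = 0" if "y \<in> \<I>" for y
    using lam that by (metis add_nonneg_eq_0_iff mult_eq_0_iff mult_nonneg_nonneg zero_le_square)
  then show ?thesis
    using ac_chain_zero_descend[OF Wr bdy(1) _ _ x] by blast
qed

text \<open>Prepending \<open>r\<close> zeros is \<open>r\<close>-fold integration from -1. The base
  \<open>max 1 \<bar>M\<bar>\<close> makes the bound monotone in the exponent, which absorbs the
  shift.\<close>

lemma exp_type_prepend:
  assumes "exp_type a"
  shows "exp_type (\<lambda>i. if i < r then 0 else a (i - r))"
proof -
  obtain K M where KM: "\<And>i. \<bar>a i\<bar> \<le> K * M ^ i" using assms unfolding exp_type_def by blast
  have "\<bar>if i < r then 0 else a (i - r)\<bar> \<le> \<bar>K\<bar> * (max 1 \<bar>M\<bar>) ^ i" for i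
  proof (cases "i < r")
    case False
    have "\<bar>a (i - r)\<bar> \<le> \<bar>K * M ^ (i - r)\<bar>" using KM[of "i - r"] by linarith
    also have "\<dots> \<le> \<bar>K\<bar> * (max 1 \<bar>M\<bar>) ^ (i - r)"
      unfolding abs_mult power_abs by (intro mult_left_mono power_mono) auto
    also have "\<dots> \<le> \<bar>K\<bar> * (max 1 \<bar>M\<bar>) ^ i"
      by (intro mult_left_mono power_increasing) auto
    finally show ?thesis using False by simp
  qed auto
  then show ?thesis unfolding exp_type_def by blast
qed

text \<open>Derivatives on \<I> are determined by the values there, so comparison with the zero
  chain suffices.\<close>

lemma smooth_chain_zero:
  assumes U: "smooth_chain U" and z: "\<And>x. x \<in> \<I> \<Longrightarrow> U 0 x = 0" and x: "x \<in> \<I>"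
  shows "U j x = 0"
proof -
  have Z: "smooth_chain (\<lambda>j x. 0)" by (simp add: smooth_chain_def)
  have "restrict (U 0) \<I> = restrict (\<lambda>x. 0) \<I>" using z by (intro restrict_ext)
  then show ?thesis
    using smooth_chain_deriv_I(1)[OF U x, of j] smooth_chain_deriv_I(1)[OF Z x, of j] by metis
qed

subsection \<open>The boundary value problem\<close>

text \<open>
  The power series is recorded because the sharpness for \<open>lam = 0\<close> uses an \<open>r\<close>-fold antiderivative
  of the solution.
\<close>

definition bvp_chain :: "nat \<Rightarrow> nat \<Rightarrow> real \<Rightarrow> (nat \<Rightarrow> real \<Rightarrow> real) \<Rightarrow> bool" where
  "bvp_chain r k lam U \<longleftrightarrow> (\<exists>a. exp_type a \<and> U = egf_chain a) \<and>
     (\<forall>x. (-1) ^ r * U (r + r) x + lam * U 0 x = 0) \<and>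
     (\<forall>s<r. U s (-1) = (if s = r - k - 1 then (-1) powi (int k - 1) else 0)) \<and>
     (\<forall>s<r. U s 1 = 0)"

lemma bvp_chain_smooth: "bvp_chain r k lam U \<Longrightarrow> smooth_chain U"
  unfolding bvp_chain_def using smooth_chain_egf by blast

lemma bvp_chain_L2: "bvp_chain r k lam U \<Longrightarrow> U j \<in> L2"
  by (intro smooth_chain_L2 bvp_chain_smooth)

text \<open>A series at -1 whose coefficients are multiplied by \<mu> after every
  \<open>n = 2 r\<close> indices solves the equation, and its first \<open>n\<close> coefficients
  are free. The boundary conditions form a square linear system for them, injective by the energy
  argument and hence solvable.\<close>

lemma bvp_chain_exists:
  assumes r: "r \<ge> 1" and lam: "lam \<ge> 0"
  shows "\<exists>U. bvp_chain r k lam U"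
proof -
  \<comment> \<open>As \<open>(-1) ^ r\<close> is its own inverse, the equation says that the
    derivative of order \<open>2 r\<close> is \<mu> times the function.\<close>
  define \<mu> where "\<mu> = - ((-1) ^ r * lam)"
  define n where "n = r + r"
  have n: "n > 0" using r by (simp add: n_def)
  \<comment> \<open>The fundamental solution whose first \<open>n\<close> coefficients are 1 at
    index \<open>m\<close> and 0 elsewhere.\<close>
  define e where "e m i = (if i mod n = m then \<mu> ^ (i div n) else 0)" for m i :: nat
  define A where "A c i = (\<Sum>m<n. c m * e m i)" for c :: "nat \<Rightarrow> real" and i
  have e_le: "\<bar>e m i\<bar> \<le> (max 1 \<bar>\<mu>\<bar>) ^ i" for m i
  proof -
    have "\<bar>e m i\<bar> \<le> \<bar>\<mu>\<bar> ^ (i div n)" by (simp add: e_def power_abs)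
    also have "\<dots> \<le> (max 1 \<bar>\<mu>\<bar>) ^ (i div n)" by (intro power_mono) auto
    also have "\<dots> \<le> (max 1 \<bar>\<mu>\<bar>) ^ i" by (intro power_increasing) auto
    finally show ?thesis .
  qed
  have e_exp: "exp_type (e m)" for m
    unfolding exp_type_def using e_le[of m] by (intro exI[of _ 1] exI[of _ "max 1 \<bar>\<mu>\<bar>"]) simp
  have A_exp: "exp_type (A c)" for c
    unfolding A_def by (rule exp_type_sum[OF e_le])
  have A_le: "A c j = c j" if "j < n" for c j
  proof -
    have "A c j = (\<Sum>m<n. if m = j then c m else 0)"
      unfolding A_def using that by (intro sum.cong) (auto simp: e_def)
    then show ?thesis using that by simp
  qed
  have A_per: "A c (n + i) = \<mu> * A c i" for c i
  proof -
    have "c m * e m (n + i) = \<mu> * (c m * e m i)" for m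
      using n by (simp add: e_def)
    then show ?thesis unfolding A_def sum_distrib_left by (intro sum.cong refl)
  qed
  have ode: "(-1) ^ r * egf_chain (A c) (r + r) x + lam * egf_chain (A c) 0 x = 0" for c x
  proof -
    have "egf_chain (A c) n x = \<mu> * egf_chain (A c) 0 x"
      unfolding egf_chain_def by (simp add: A_per egf_cmult[OF A_exp])
    then show ?thesis
      by (simp add: n_def \<mu>_def mult.assoc[symmetric] power_mult_distrib[symmetric])
  qed
  \<comment> \<open>The first \<open>r\<close> rows give the data at -1, which are the coefficients
    themselves; the other rows give the derivatives at 1.\<close>
  define M where "M i j = (if i < r then (if i = j then 1 else 0) else egf_chain (e j) (i - r) 1)" for i j
  have M_sum: "(\<Sum>j<n. M i j * c j) = (if i < r then c i else egf_chain (A c) (i - r) 1)" if "i < n" for i c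
  proof (cases "i < r")
    case True
    then have "(\<Sum>j<n. M i j * c j) = (\<Sum>j<n. if j = i then c j else 0)"
      by (intro sum.cong) (auto simp: M_def)
    then show ?thesis using True that by simp
  next
    case False
    then show ?thesis
      unfolding A_def using e_exp by (subst egf_chain_sum) (auto simp: M_def mult.commute)
  qed
  have "\<exists>c. \<forall>i<n. (\<Sum>j<n. M i j * c j) =
      (if i < r then (if i = r - k - 1 then (-1) powi (int k - 1) else 0) else 0)"
  proof (rule injective_system_solvable)
    fix c assume c: "\<forall>i<n. (\<Sum>j<n. M i j * c j) = 0"
    have c0: "c i = 0" if "i < r" for i
      using c[rule_format, of i] M_sum[of i c] that by (simp add: n_def)
    have c1: "egf_chain (A c) i 1 = 0" if "i < r" for i
      using c[rule_format, of "r + i"] M_sum[of "r + i" c] that by (simp add: n_def)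
    have sm: "smooth_chain (egf_chain (A c))" by (rule smooth_chain_egf[OF A_exp])
    have c2: "egf_chain (A c) i (-1) = 0" if "i < r" for i
      using c0 that A_le[of i c] by (simp add: egf_chain_minus_one n_def)
    have z: "egf_chain (A c) 0 x = 0" if "x \<in> \<I>" for x
      by (rule energy_uniqueness[OF r lam smooth_chain_ac_chain[OF sm] negligible_empty ode c2 c1 that])
    have "egf_chain (A c) j (-1) = 0" for j
      by (rule smooth_chain_zero[OF sm z]) simp_all
    then show "\<forall>j<n. c j = 0"
      using A_le[of _ c] by (metis egf_chain_minus_one)
  qed
  then obtain c where c: "\<forall>i<n. (\<Sum>j<n. M i j * c j) =
      (if i < r then (if i = r - k - 1 then (-1) powi (int k - 1) else 0) else 0)"
    by blast
  have "bvp_chain r k lam (egf_chain (A c))"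
    unfolding bvp_chain_def
  proof (intro conjI allI impI ode)
    show "\<exists>a. exp_type a \<and> egf_chain (A c) = egf_chain a" using A_exp by blast
    fix s assume s: "s < r"
    show "egf_chain (A c) s (-1) = (if s = r - k - 1 then (-1) powi (int k - 1) else 0)"
      using c[rule_format, of s] M_sum[of s c] A_le[of s c] s by (simp add: n_def egf_chain_minus_one)
    show "egf_chain (A c) s 1 = 0"
      using c[rule_format, of "r + s"] M_sum[of "r + s" c] s by (simp add: n_def)
  qed
  then show ?thesis by blast
qed

lemma bvp_chain_solution:
  assumes U: "bvp_chain r k lam U"
  shows "bvp_solution r k lam (restrict (U 0) \<I>)"
proof -
  note d = smooth_chain_deriv_I[OF bvp_chain_smooth[OF U]]
  define u where "u = restrict (U 0) \<I>"
  have u: "deriv_I j u x = U j x" "deriv_I j u differentiable (at x within \<I>)" if "x \<in> \<I>" for j x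
    using d[OF that, of j] unfolding u_def by (auto intro: differentiableI_vector)
  have u0: "u x = U 0 x" if "x \<in> \<I>" for x using that by (simp add: u_def)
  have "u \<in> L2_space (2 * r)"
    unfolding u_def by (rule smooth_chain_L2_space[OF bvp_chain_smooth[OF U]])
  moreover have "\<forall>x\<in>{-1<..<1}. deriv_I (2 * r - 1) u differentiable (at x within \<I>) \<and>
        (-1) ^ r * deriv_I (2 * r) u x + lam * u x = 0"
    using U u u0 by (auto simp: bvp_chain_def mult_2)
  ultimately show ?thesis
    using U u unfolding bvp_solution_def u_def[symmetric] by (auto simp: bvp_chain_def)
qed

lemma bvp_solution_unique:
  assumes r: "r \<ge> 1" and lam: "lam \<ge> 0" and u: "bvp_solution r k lam u" and v: "bvp_solution r k lam v"
  shows "u = v"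
proof -
  have r2: "2 * r \<ge> 1" using r by simp
  have uv: "u \<in> L2_space (2 * r)" "v \<in> L2_space (2 * r)"
    using u v by (auto simp: bvp_solution_def)
  define W where "W j x = deriv_I j u x - deriv_I j v x" for j x
  have W: "ac_chain (-1) 1 (r + r) W"
    unfolding W_def[abs_def] mult_2[symmetric]
    by (intro ac_chain_diff L2_space_ac_chain uv r2)
  have "W 0 x = 0" if "x \<in> \<I>" for x
  proof (rule energy_uniqueness[OF r lam W _ _ _ _ that])
    \<comment> \<open>The equation is imposed only in the open interval, so the end points are
      exceptional.\<close>
    show "negligible {-1, 1::real}" by (simp add: negligible_finite)
    fix x assume "x \<in> \<I> - {-1, 1::real}"
    then have "x \<in> {-1<..<1}" by auto
    then have "(-1) ^ r * deriv_I (2 * r) u x + lam * u x = 0" "(-1) ^ r * deriv_I (2 * r) v x + lam * v x = 0"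
      using u v unfolding bvp_solution_def by blast+
    then show "(-1) ^ r * W (r + r) x + lam * W 0 x = 0"
      unfolding W_def mult_2[symmetric] by (simp add: right_diff_distrib)
  qed (use u v in \<open>auto simp: W_def bvp_solution_def\<close>)
  then have "u x = v x" if "x \<in> \<I>" for x using that by (simp add: W_def)
  moreover have "u \<in> extensional \<I>" "v \<in> extensional \<I>" using uv by (auto simp: L2_space_def)
  ultimately show ?thesis by (intro extensionalityI)
qed

lemma u_sol_eq:
  assumes "r \<ge> 1" "lam \<ge> 0" and U: "bvp_chain r k lam U"
  shows "u_sol r k lam = restrict (U 0) \<I>"
  unfolding u_sol_def
  using bvp_chain_solution[OF U] bvp_solution_unique[OF assms(1,2)] by blast

lemma norm2_u_sol:
  assumes "r \<ge> 1" "lam \<ge> 0" and U: "bvp_chain r k lam U"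
  shows "norm2 (deriv_I r (u_sol r k lam)) = norm2 (U r)" "norm2 (u_sol r k lam) = norm2 (U 0)"
  unfolding u_sol_eq[OF assms]
  by (rule norm2_cong, simp only: smooth_chain_deriv_I[OF bvp_chain_smooth[OF U]])
     (rule norm2_cong, simp)

subsection \<open>The inequality and its sharpness\<close>

text \<open>Among the boundary terms, all at 1 vanish and at -1 only \<open>j = r - k - 1\<close>
  survives, where \<open>F\<close> appears with order \<open>k\<close>. The sign in the boundary
  condition is chosen so that this term becomes \<open>(-1) ^ r * F k (-1)\<close>.\<close>

lemma point_evaluation_identity:
  assumes k: "k \<le> r - 1" and r: "r \<ge> 1" and U: "bvp_chain r k lam U"
    and F: "ac_chain (-1) 1 r F" "F 0 \<in> L2" "F r \<in> L2"
  shows "F k (-1) = ip (F 0) (U r) - (-1) ^ r * ip (F r) (U 0)"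
proof -
  have UL: "U j \<in> L2" for j by (rule bvp_chain_L2[OF U])
  have bdy: "U j (-1) = (if j = r - k - 1 then (-1) powi (int k - 1) else 0)" "U j 1 = 0" if "j < r" for j
    using U that by (auto simp: bvp_chain_def)
  have sign: "(-1) ^ (r - k - 1) * (-1) powi (int k - 1) = ((-1) ^ r :: real)"
  proof -
    have "(-1) powi (int k - 1) = - ((-1) ^ k :: real)"
      by (simp add: power_int_diff)
    moreover have "r = r - k - 1 + k + 1" using k r by simp
    then have "(-1) ^ r = (-1) ^ (r - k - 1) * (-1) ^ k * (-1 :: real)"
      by (metis power_add power_one_right)
    ultimately show ?thesis by simp
  qed
  have "(\<Sum>j<r. (-1)^j * (F (r - 1 - j) (-1) * U j (-1))) =
      (\<Sum>j<r. if j = r - k - 1 then (-1)^j * (F (r - 1 - j) (-1) * (-1) powi (int k - 1)) else 0)"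
    using bdy by (intro sum.cong) auto
  also have "\<dots> = (-1) ^ (r - k - 1) * (F (r - 1 - (r - k - 1)) (-1) * (-1) powi (int k - 1))"
    using r by simp
  also have "\<dots> = (-1) ^ r * F k (-1)"
  proof -
    have "r - 1 - (r - k - 1) = k" using k r by simp
    then show ?thesis unfolding sign[symmetric] by simp
  qed
  finally have S: "(\<Sum>j<r. (-1)^j * (F (r - 1 - j) (-1) * U j (-1))) = (-1) ^ r * F k (-1)" .
  have "((\<lambda>x. F r x * U 0 x - (-1)^r * (F 0 x * U r x)) has_integral - ((-1) ^ r * F k (-1))) \<I>"
    using telescoping_integration_by_parts[OF _ F(1) smooth_chain_ac_chain[OF bvp_chain_smooth[OF U]]] S bdy by simp
  moreover have "((\<lambda>x. F r x * U 0 x - (-1)^r * (F 0 x * U r x)) has_integral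
      ip (F r) (U 0) - (-1) ^ r * ip (F 0) (U r)) \<I>"
    using ip_eq_integral[OF F(3) UL] ip_eq_integral[OF F(2) UL]
    by (intro has_integral_diff has_integral_mult_right) (simp_all add: has_integral_integral)
  ultimately have "- ((-1) ^ r * F k (-1)) = ip (F r) (U 0) - (-1) ^ r * ip (F 0) (U r)"
    by (rule has_integral_unique)
  \<comment> \<open>Multiplying by \<open>(-1) ^ r\<close>, its own inverse, isolates
    \<open>F k (-1)\<close>.\<close>
  then have "(-1) ^ r * (- ((-1) ^ r * F k (-1))) = (-1) ^ r * (ip (F r) (U 0) - (-1) ^ r * ip (F 0) (U r))"
    by simp
  then show ?thesis
    by (simp add: right_diff_distrib mult.assoc[symmetric] power_mult_distrib[symmetric])
qed

lemma point_evaluation_bound: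
  assumes k: "k \<le> r - 1" and r: "r \<ge> 1" and U: "bvp_chain r k lam U"
    and F: "ac_chain (-1) 1 r F" "F 0 \<in> L2" "F r \<in> L2"
  shows "\<bar>F k (-1)\<bar> \<le> norm2 (U r) * norm2 (F 0) + norm2 (U 0) * norm2 (F r)"
proof -
  have "\<bar>F k (-1)\<bar> \<le> \<bar>ip (F 0) (U r)\<bar> + \<bar>(-1) ^ r * ip (F r) (U 0)\<bar>"
    unfolding point_evaluation_identity[OF assms] by (rule abs_triangle_ineq4)
  also have "\<dots> \<le> norm2 (F 0) * norm2 (U r) + norm2 (F r) * norm2 (U 0)"
    using ip_Cauchy_Schwarz[OF F(2) bvp_chain_L2[OF U, of r]] ip_Cauchy_Schwarz[OF F(3) bvp_chain_L2[OF U, of 0]]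
    by (simp add: abs_mult power_abs)
  finally show ?thesis by (simp add: mult.commute)
qed

lemma L2_space_bound:
  assumes k: "k \<le> r - 1" and r: "r \<ge> 1" and U: "bvp_chain r k lam U" and f: "f \<in> L2_space r"
  shows "\<bar>deriv_I k f (-1)\<bar> \<le> norm2 (U r) * norm2 f + norm2 (U 0) * norm2 (deriv_I r f)"
  using point_evaluation_bound[OF k r U L2_space_ac_chain[OF f r]] L2_space_L2[OF f r] by simp

lemma smooth_chain_norm2:
  assumes F: "smooth_chain F"
  shows "norm2 (deriv_I j (restrict (F 0) \<I>)) = norm2 (F j)"
  by (rule norm2_cong, simp only: smooth_chain_deriv_I[OF F])

lemma B_left_ge:
  assumes F: "smooth_chain F" and le: "norm2 (F r) \<le> 1"
  shows "ereal (\<bar>F k (-1)\<bar> - A * norm2 (F 0)) \<le> B_left r k A"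
proof -
  define f where "f = restrict (F 0) \<I>"
  have "f \<in> W_class r"
    unfolding W_class_def f_def using smooth_chain_L2_space[OF F] smooth_chain_norm2[OF F, of r] le by simp
  moreover have "deriv_I k f (-1) = F k (-1)"
    unfolding f_def by (rule smooth_chain_deriv_I[OF F]) simp
  moreover have "norm2 f = norm2 (F 0)"
    unfolding f_def using smooth_chain_norm2[OF F, of 0] by simp
  ultimately show ?thesis
    unfolding B_left_def by (intro SUP_upper2[of f]) auto
qed

text \<open>A zero norm would make the continuous function \<open>U 0\<close>, hence every
  derivative, vanish on \<I>, although the derivative of order \<open>r - k - 1\<close> at -1 is a
  sign.\<close>

lemma norm2_bvp_chain_pos:
  assumes k: "k \<le> r - 1" and r: "r \<ge> 1" and U: "bvp_chain r k lam U"
  shows "norm2 (U 0) > 0"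
proof (rule ccontr)
  assume "\<not> norm2 (U 0) > 0"
  then have "norm2 (U 0) = 0" using norm2_nonneg[of "U 0"] by linarith
  then have "ip (U 0) (U 0) = 0" using norm2_square[of "U 0"] by simp
  then have int: "((\<lambda>x. U 0 x * U 0 x) has_integral 0) (cbox (-1) 1)"
    using ip_eq_integral[OF bvp_chain_L2[OF U] bvp_chain_L2[OF U], of 0 0] by (simp add: has_integral_iff)
  have z: "U 0 x = 0" if "x \<in> \<I>" for x
  proof -
    have "continuous_on (cbox (-1) 1) (\<lambda>x. U 0 x * U 0 x)"
      by (intro continuous_intros smooth_chain_continuous_on bvp_chain_smooth[OF U])
    then have "U 0 x * U 0 x = 0"
      using that by (intro has_integral_0_cbox_imp_0[OF _ _ int]) auto
    then show ?thesis by simp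
  qed
  have "U (r - k - 1) (-1) = 0"
    by (rule smooth_chain_zero[OF bvp_chain_smooth[OF U] z]) simp_all
  moreover have "U (r - k - 1) (-1) = (-1) powi (int k - 1)"
    using U k r by (simp add: bvp_chain_def)
  ultimately show False by simp
qed

text \<open>The extremal function is a multiple of the derivative of order \<open>r\<close> of the
  solution: by the equation its own derivative of order \<open>r\<close> is a multiple of
  \<open>U 0\<close>, so both Cauchy-Schwarz inequalities become equalities.\<close>

lemma B_left_ge_positive:
  assumes k: "k \<le> r - 1" and r: "r \<ge> 1" and lam: "lam > 0" and U: "bvp_chain r k lam U"
  shows "ereal (norm2 (U 0)) \<le> B_left r k (norm2 (U r))"
proof -
  define B where "B = norm2 (U 0)"
  have B: "B > 0" unfolding B_def by (rule norm2_bvp_chain_pos[OF k r U])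
  \<comment> \<open>Normalises \<open>norm2 (F r)\<close> to 1; this is where \<open>lam > 0\<close>
    enters.\<close>
  define c where "c = 1 / (lam * B)"
  have c: "c > 0" using B lam by (simp add: c_def)
  define F where "F j x = c * U (r + j) x + 0 * U j x" for j x
  have F: "smooth_chain F"
    unfolding F_def by (intro smooth_chain_lincomb smooth_chain_shift bvp_chain_smooth[OF U])
  have F0: "F 0 = (\<lambda>x. c * U r x + 0 * U 0 x)" by (simp add: F_def fun_eq_iff)
  have Fr: "F r = (\<lambda>x. (- (c * lam * (-1) ^ r)) * U 0 x + 0 * U 0 x)"
  proof
    fix x
    have "(-1) ^ r * U (r + r) x + lam * U 0 x = 0" using U by (simp add: bvp_chain_def)
    then have "(-1) ^ r * ((-1) ^ r * U (r + r) x) = (-1) ^ r * (- (lam * U 0 x))"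
      by (simp add: add_eq_0_iff)
    then have "U (r + r) x = - ((-1) ^ r * lam * U 0 x)"
      by (simp add: mult.assoc[symmetric] power_mult_distrib[symmetric])
    then show "F r x = (- (c * lam * (-1) ^ r)) * U 0 x + 0 * U 0 x"
      by (simp add: F_def)
  qed
  have UL: "U j \<in> L2" for j by (rule bvp_chain_L2[OF U])
  have n0: "norm2 (F 0) = c * norm2 (U r)"
    unfolding F0 using c by (simp add: norm2_cmult)
  have nr: "norm2 (F r) = 1"
    unfolding Fr using norm2_cmult[of "- (c * lam * (-1) ^ r)" "U 0"] B lam
    by (simp add: abs_mult power_abs c_def B_def[symmetric])
  have "F k (-1) = ip (F 0) (U r) - (-1) ^ r * ip (F r) (U 0)"
    by (rule point_evaluation_identity[OF k r U smooth_chain_ac_chain[OF F] smooth_chain_L2[OF F] smooth_chain_L2[OF F]])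
  also have "ip (F 0) (U r) = c * (norm2 (U r))\<^sup>2"
    unfolding F0 norm2_square by (subst ip_lincomb[OF UL UL UL]) simp
  also have "ip (F r) (U 0) = (- (c * lam * (-1) ^ r)) * B\<^sup>2"
    unfolding Fr norm2_square B_def by (subst ip_lincomb[OF UL UL UL]) simp
  finally have "F k (-1) = c * (norm2 (U r))\<^sup>2 + c * lam * B\<^sup>2"
    by (simp add: mult.assoc[symmetric] mult.commute[of "(-1) ^ r"])
  also have "c * lam * B\<^sup>2 = B" using lam B by (simp add: c_def power2_eq_square)
  finally have "\<bar>F k (-1)\<bar> - norm2 (U r) * norm2 (F 0) \<ge> B"
    unfolding n0 by (simp add: power2_eq_square algebra_simps)
  then have "ereal B \<le> ereal (\<bar>F k (-1)\<bar> - norm2 (U r) * norm2 (F 0))" by simp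
  also have "\<dots> \<le> B_left r k (norm2 (U r))" by (rule B_left_ge[OF F]) (simp add: nr)
  finally show ?thesis by (simp add: B_def)
qed

text \<open>
  For \<open>lam = 0\<close> the supremum is approached along \<open>H + t D\<^sup>r u\<close> as \<open>t\<close> tends to infinity, where
  \<open>D\<^sup>r H\<close> is a normalised multiple of \<open>u\<close>.
\<close>

lemma B_left_ge_zero:
  assumes k: "k \<le> r - 1" and r: "r \<ge> 1" and U: "bvp_chain r k 0 U"
  shows "ereal (norm2 (U 0)) \<le> B_left r k (norm2 (U r))"
proof -
  define B where "B = norm2 (U 0)"
  have B: "B > 0" unfolding B_def by (rule norm2_bvp_chain_pos[OF k r U])
  have UL: "U j \<in> L2" for j by (rule bvp_chain_L2[OF U])
  obtain a where a: "exp_type a" "U = egf_chain a" using U by (auto simp: bvp_chain_def)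
  \<comment> \<open>An \<open>r\<close>-fold antiderivative of \<open>U 0\<close>.\<close>
  define G where "G = egf_chain (\<lambda>i. if i < r then 0 else a (i - r))"
  have G: "smooth_chain G" unfolding G_def by (intro smooth_chain_egf exp_type_prepend a)
  have Gr: "G r = U 0" by (rule ext) (simp add: G_def a(2) egf_chain_def)
  \<comment> \<open>The modulus gives \<open>H r\<close> norm 1, and the sign makes its contribution
    to the point evaluation equal to \<open>+ B\<close>.\<close>
  define s where "s = - ((-1) ^ r / B)"
  define H where "H j x = s * G j x + 0 * G j x" for j x
  have H: "smooth_chain H" unfolding H_def by (intro smooth_chain_lincomb G)
  have Hr: "H r = (\<lambda>x. s * U 0 x + 0 * U 0 x)" by (simp add: H_def Gr fun_eq_iff)
  have HL: "H j \<in> L2" for j by (rule smooth_chain_L2[OF H])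
  define q where "q = ip (H 0) (U r)"
  define P where "P = norm2 (U r)"
  define h where "h = norm2 (H 0)"
  \<comment> \<open>For large \<open>t\<close> the norm of \<open>F 0\<close> times \<open>P\<close>
    exceeds \<open>t * P\<^sup>2 + q\<close> by at most \<open>h\<^sup>2 / (2 * t)\<close>, which is
    therefore the loss against \<open>B\<close>.\<close>
  have main: "ereal (B - h\<^sup>2 / (2 * t)) \<le> B_left r k P" if t: "t > 0" for t
  proof -
    define F where "F j x = 1 * H j x + t * U (r + j) x" for j x
    have F: "smooth_chain F"
      unfolding F_def by (intro smooth_chain_lincomb smooth_chain_shift bvp_chain_smooth[OF U] H)
    have F0: "F 0 = (\<lambda>x. 1 * H 0 x + t * U r x)" by (simp add: F_def fun_eq_iff)
    have Fr: "F r = (\<lambda>x. s * U 0 x + 0 * U 0 x)"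
      using U Hr by (auto simp: F_def bvp_chain_def fun_eq_iff)
    have nr: "norm2 (F r) = 1"
      unfolding Fr using norm2_cmult[of s "U 0"] B by (simp add: s_def abs_mult power_abs B_def[symmetric])
    have n0: "(norm2 (F 0))\<^sup>2 = h\<^sup>2 + 2 * t * q + t\<^sup>2 * P\<^sup>2"
      unfolding F0 norm2_lincomb_square[OF HL UL] by (simp add: h_def q_def P_def)
    have "F k (-1) = ip (F 0) (U r) - (-1) ^ r * ip (F r) (U 0)"
      by (rule point_evaluation_identity[OF k r U smooth_chain_ac_chain[OF F] smooth_chain_L2[OF F] smooth_chain_L2[OF F]])
    also have "ip (F 0) (U r) = q + t * P\<^sup>2"
      unfolding F0 norm2_square P_def q_def by (subst ip_lincomb[OF HL UL UL]) simp
    also have "ip (F r) (U 0) = s * B\<^sup>2"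
      unfolding Fr norm2_square B_def by (subst ip_lincomb[OF UL UL UL]) simp
    also have "(-1) ^ r * (s * B\<^sup>2) = - B"
      using B by (simp add: s_def power2_eq_square mult.assoc[symmetric] power_mult_distrib[symmetric])
    finally have Fk: "F k (-1) = q + t * P\<^sup>2 + B" by simp
    have "P * norm2 (F 0) \<le> t * P\<^sup>2 + q + h\<^sup>2 / (2 * t)"
    proof (rule power2_le_imp_le)
      have "0 \<le> (t\<^sup>2 * P\<^sup>2 + (norm2 (F 0))\<^sup>2) / (2 * t)" using t by simp
      also have "\<dots> = t * P\<^sup>2 + q + h\<^sup>2 / (2 * t)"
        unfolding n0 using t by (simp add: field_simps power2_eq_square)
      finally show "0 \<le> t * P\<^sup>2 + q + h\<^sup>2 / (2 * t)" .
      have "(t * P\<^sup>2 + q + h\<^sup>2 / (2 * t))\<^sup>2 - (P * norm2 (F 0))\<^sup>2 = (q + h\<^sup>2 / (2 * t))\<^sup>2"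
        unfolding power_mult_distrib n0 using t by (simp add: field_simps power2_eq_square)
      then show "(P * norm2 (F 0))\<^sup>2 \<le> (t * P\<^sup>2 + q + h\<^sup>2 / (2 * t))\<^sup>2"
        by (metis diff_ge_0_iff_ge zero_le_power2)
    qed
    then have "B - h\<^sup>2 / (2 * t) \<le> \<bar>F k (-1)\<bar> - P * norm2 (F 0)"
      using Fk by linarith
    then have "ereal (B - h\<^sup>2 / (2 * t)) \<le> ereal (\<bar>F k (-1)\<bar> - P * norm2 (F 0))" by simp
    also have "\<dots> \<le> B_left r k P" by (rule B_left_ge[OF F]) (simp add: nr)
    finally show ?thesis .
  qed
  have "ereal B \<le> B_left r k P"
  proof (rule ereal_le_epsilon2)
    fix e :: real assume e: "e > 0"
    \<comment> \<open>Makes the loss at most \<open>e\<close>; the summand 1 keeps \<open>t\<close>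
      positive when \<open>h = 0\<close>.\<close>
    define t where "t = (h\<^sup>2 + 1) / (2 * e)"
    have t: "t > 0" using e by (simp add: t_def add_nonneg_pos)
    have "e * (2 * t) = h\<^sup>2 + 1" using e by (simp add: t_def)
    then have "h\<^sup>2 / (2 * t) \<le> e" using t by (simp add: pos_divide_le_eq)
    then have "ereal (B - e) \<le> ereal (B - h\<^sup>2 / (2 * t))" by simp
    also have "\<dots> \<le> B_left r k P" by (rule main[OF t])
    finally have "ereal (B - e) + ereal e \<le> B_left r k P + ereal e" by (rule add_right_mono)
    then show "ereal B \<le> B_left r k P + ereal e" by simp
  qed
  then show ?thesis by (simp add: B_def P_def)
qed

lemma B_left_bvp_chain:
  assumes k: "k \<le> r - 1" and r: "r \<ge> 1" and lam: "lam \<ge> 0" and U: "bvp_chain r k lam U"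
  shows "B_left r k (norm2 (U r)) = ereal (norm2 (U 0))"
proof (rule antisym)
  show "ereal (norm2 (U 0)) \<le> B_left r k (norm2 (U r))"
    using B_left_ge_positive[OF k r _ U] B_left_ge_zero[OF k r] lam U by (cases "lam = 0") auto
  show "B_left r k (norm2 (U r)) \<le> ereal (norm2 (U 0))"
    unfolding B_left_def
  proof (rule SUP_least)
    fix f assume "f \<in> W_class r"
    then have f: "f \<in> L2_space r" "norm2 (deriv_I r f) \<le> 1" by (auto simp: W_class_def)
    have "norm2 (U 0) * norm2 (deriv_I r f) \<le> norm2 (U 0) * 1"
      by (intro mult_left_mono f) simp
    then show "ereal (\<bar>deriv_I k f (-1)\<bar> - norm2 (U r) * norm2 f) \<le> ereal (norm2 (U 0))"
      using L2_space_bound[OF k r U f(1)] by simp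
  qed
qed

subsection \<open>Dependence of the norms on the spectral parameter\<close>

text \<open>The weak form of the equation: every boundary term contains a derivative of
  \<open>W\<close> of order below \<open>r\<close>.\<close>

lemma bvp_chain_orthogonality:
  assumes U: "bvp_chain r k lam U" and W: "smooth_chain W"
    and bdy: "\<And>s. s < r \<Longrightarrow> W s (-1) = 0" "\<And>s. s < r \<Longrightarrow> W s 1 = 0"
  shows "ip (W r) (U r) + lam * ip (W 0) (U 0) = 0"
proof -
  have UL: "U j \<in> L2" for j by (rule bvp_chain_L2[OF U])
  have WL: "W j \<in> L2" for j by (rule smooth_chain_L2[OF W])
  have ode: "(-1) ^ r * U (r + r) x + lam * U 0 x = 0" for x using U by (simp add: bvp_chain_def)
  have "((\<lambda>x. W r x * U r x + lam * (W 0 x * U 0 x)) has_integral 0) \<I>"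
    using energy_identity[OF _ smooth_chain_ac_chain[OF W] smooth_chain_ac_chain[OF bvp_chain_smooth[OF U]]
        negligible_empty ode, of "-1" 1] bdy by simp
  moreover have "((\<lambda>x. W r x * U r x + lam * (W 0 x * U 0 x)) has_integral
      ip (W r) (U r) + lam * ip (W 0) (U 0)) \<I>"
    using ip_eq_integral[OF WL UL]
    by (intro has_integral_add has_integral_mult_right) (simp_all add: has_integral_integral)
  ultimately show ?thesis by (metis has_integral_unique)
qed

text \<open>The difference \<open>W\<close> of two solutions has zero boundary data, so both weak
  equations may be tested with it; subtracting them bounds the energy of \<open>W\<close> by
  \<open>\<bar>mu - lam\<bar>\<close> times an inner product. Only \<open>lam\<close> has to be
  positive, so \<open>mu = 0\<close> remains available for continuity at 0.\<close>

lemma norm2_bvp_chain_diff: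
  assumes lam: "lam > 0" and U: "bvp_chain r k lam U" and V: "bvp_chain r k mu V"
  shows "\<bar>norm2 (U r) - norm2 (V r)\<bar> \<le> \<bar>mu - lam\<bar> * norm2 (V 0) / sqrt lam"
proof -
  have UL: "U j \<in> L2" and VL: "V j \<in> L2" for j
    using bvp_chain_L2[OF U] bvp_chain_L2[OF V] by auto
  define W where "W j x = 1 * U j x + (-1) * V j x" for j x
  have W: "smooth_chain W"
    unfolding W_def by (intro smooth_chain_lincomb bvp_chain_smooth[OF U] bvp_chain_smooth[OF V])
  have WL: "W j \<in> L2" for j by (rule smooth_chain_L2[OF W])
  have W': "W j = (\<lambda>x. 1 * U j x + (-1) * V j x)" for j by (simp add: W_def fun_eq_iff)
  have bdy: "W s (-1) = 0" "W s 1 = 0" if "s < r" for s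
    using U V that by (auto simp: W_def bvp_chain_def)
  have orth: "ip (W r) (U r) + lam * ip (W 0) (U 0) = 0" "ip (W r) (V r) + mu * ip (W 0) (V 0) = 0"
    using bvp_chain_orthogonality[OF U W] bvp_chain_orthogonality[OF V W] bdy by auto
  have sq: "(norm2 (W j))\<^sup>2 = ip (W j) (U j) - ip (W j) (V j)" for j
    using ip_lincomb[OF UL VL WL, of 1 j "-1" j j] unfolding W'[symmetric] norm2_square
    by (simp only: ip_commute[of "U j"] ip_commute[of "V j"])
  have E: "(norm2 (W r))\<^sup>2 + lam * (norm2 (W 0))\<^sup>2 = (mu - lam) * ip (W 0) (V 0)"
    using orth unfolding sq right_diff_distrib left_diff_distrib by linarith
  define w v d where "w = norm2 (W 0)" and "v = norm2 (V 0)" and "d = \<bar>mu - lam\<bar>"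
  have nn: "w \<ge> 0" "v \<ge> 0" "d \<ge> 0" by (auto simp: w_def v_def d_def)
  have "(mu - lam) * ip (W 0) (V 0) \<le> d * \<bar>ip (W 0) (V 0)\<bar>"
    unfolding d_def abs_mult[symmetric] by simp
  also have "\<dots> \<le> d * (w * v)"
    unfolding w_def v_def by (intro mult_left_mono ip_Cauchy_Schwarz WL VL nn)
  finally have E2: "(norm2 (W r))\<^sup>2 + lam * w\<^sup>2 \<le> d * v * w"
    using E by (simp add: w_def algebra_simps)
  have "lam * w\<^sup>2 \<le> d * v * w" using E2 zero_le_power2[of "norm2 (W r)"] by linarith
  then have "lam * w \<le> d * v"
    using nn lam by (cases "w = 0") (auto simp: power2_eq_square)
  then have "w \<le> d * v / lam" using lam by (simp add: field_simps)
  then have "d * v * w \<le> d * v * (d * v / lam)" using nn by (intro mult_left_mono) auto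
  have "(norm2 (W r))\<^sup>2 \<le> d * v * (d * v / lam)"
  proof -
    have "0 \<le> lam * w\<^sup>2" using lam by simp
    then show ?thesis using E2 \<open>d * v * w \<le> d * v * (d * v / lam)\<close> by linarith
  qed
  also have "\<dots> = (d * v / sqrt lam)\<^sup>2"
    using lam unfolding power_divide by (simp add: power2_eq_square)
  finally have "norm2 (W r) \<le> d * v / sqrt lam"
    by (rule power2_le_imp_le) (use nn lam in simp)
  moreover have "\<bar>norm2 (U r) - norm2 (V r)\<bar> \<le> norm2 (W r)"
    using norm2_diff_le[OF UL VL] by (simp add: W')
  ultimately show ?thesis by (simp add: d_def v_def)
qed

lemma continuous_on_norm2_bvp_chain:
  assumes U: "\<And>lam. lam \<ge> 0 \<Longrightarrow> bvp_chain r k lam (U lam)"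
  shows "continuous_on {0..} (\<lambda>lam. norm2 (U lam r))"
  unfolding continuous_on_def
proof
  fix mu :: real assume mu: "mu \<in> {0..}"
  define B where "B = norm2 (U mu 0)"
  have bound: "\<bar>norm2 (U lam r) - norm2 (U mu r)\<bar> \<le> \<bar>mu - lam\<bar> * B / sqrt lam" if "lam > 0" for lam
    unfolding B_def using that mu by (intro norm2_bvp_chain_diff[OF that U U]) auto
  have lim: "((\<lambda>lam. \<bar>mu - lam\<bar> * B / sqrt lam) \<longlongrightarrow> 0) (at mu within {0..})"
  proof (cases "mu = 0")
    case True
    \<comment> \<open>At \<open>mu = 0\<close> the factor \<open>lam\<close> beats the denominator
      \<open>sqrt lam\<close>.\<close>
    have "((\<lambda>lam. sqrt lam * B) \<longlongrightarrow> sqrt 0 * B) (at 0 within {0..})"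
      by (intro tendsto_intros)
    moreover have "\<forall>\<^sub>F lam in at 0 within {0..}. sqrt lam * B = \<bar>mu - lam\<bar> * B / sqrt lam"
      unfolding eventually_at_filter True
      by (intro always_eventually) (auto simp: real_div_sqrt field_simps)
    ultimately show ?thesis using tendsto_cong True by fastforce
  next
    case False
    then have "((\<lambda>lam. \<bar>mu - lam\<bar> * B / sqrt lam) \<longlongrightarrow> \<bar>mu - mu\<bar> * B / sqrt mu) (at mu within {0..})"
      using mu by (intro tendsto_intros) auto
    then show ?thesis by simp
  qed
  have "((\<lambda>lam. norm2 (U lam r) - norm2 (U mu r)) \<longlongrightarrow> 0) (at mu within {0..})"
  proof (rule Lim_null_comparison[OF _ lim])
    have "\<forall>\<^sub>F lam in at mu within {0..}. lam > 0"
    proof (cases "mu = 0")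
      case True
      then show ?thesis unfolding eventually_at_filter by (intro always_eventually) auto
    next
      case False
      then show ?thesis using mu by (intro order_tendstoD(1)[OF tendsto_ident_at]) auto
    qed
    then show "\<forall>\<^sub>F lam in at mu within {0..}. norm (norm2 (U lam r) - norm2 (U mu r)) \<le> \<bar>mu - lam\<bar> * B / sqrt lam"
      by eventually_elim (use bound in simp)
  qed
  then show "((\<lambda>lam. norm2 (U lam r)) \<longlongrightarrow> norm2 (U mu r)) (at mu within {0..})"
    by (rule LIM_zero_cancel)
qed

text \<open>Minimality of the energy, for a competitor living only on the shorter interval. Its
  pairing with \<open>U\<close> there equals the full energy \<open>E\<close> of \<open>U\<close>,
  since the boundary data at -1 agree and those at \<open>c\<close> vanish. Pointwise, a product is
  at most the mean of the squares, so \<open>E \<le> (EV + EU) / 2\<close>, and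
  \<open>EU \<le> E\<close> finishes.\<close>

lemma bvp_chain_energy_le:
  assumes lam: "lam \<ge> 0" and U: "bvp_chain r k lam U" and c: "-1 \<le> c" "c \<le> 1" and V: "smooth_chain V"
    and bdy: "\<And>s. s < r \<Longrightarrow> V s (-1) = U s (-1)" "\<And>s. s < r \<Longrightarrow> V s c = 0"
  shows "lam * (norm2 (U 0))\<^sup>2 \<le> integral {-1..c} (\<lambda>x. V r x * V r x) + lam * integral {-1..c} (\<lambda>x. V 0 x * V 0 x)"
proof -
  have UL: "U j \<in> L2" for j by (rule bvp_chain_L2[OF U])
  note U' = bvp_chain_smooth[OF U]
  have ode: "(-1) ^ r * U (r + r) x + lam * U 0 x = 0" for x using U by (simp add: bvp_chain_def)
  define S where "S = (\<Sum>j<r. (-1)^j * (U (r - 1 - j) (-1) * U (r + j) (-1)))"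
  define E where "E = (norm2 (U r))\<^sup>2 + lam * (norm2 (U 0))\<^sup>2"
  have "((\<lambda>x. U r x * U r x + lam * (U 0 x * U 0 x)) has_integral - S) \<I>"
    using energy_identity[OF _ smooth_chain_ac_chain[OF U'] smooth_chain_ac_chain[OF U']
        negligible_empty ode, of "-1" 1] U by (simp add: S_def bvp_chain_def)
  moreover have UI: "((\<lambda>x. U r x * U r x + lam * (U 0 x * U 0 x)) has_integral E) \<I>"
    unfolding E_def norm2_square using ip_eq_integral[OF UL UL]
    by (intro has_integral_add has_integral_mult_right) (simp_all add: has_integral_integral)
  ultimately have SE: "- S = E" by (rule has_integral_unique)
  have S': "(\<Sum>j<r. (-1)^j * (V (r - 1 - j) (-1) * U (r + j) (-1))) = S"
    unfolding S_def using bdy(1) by (intro sum.cong) auto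
  have VU: "((\<lambda>x. V r x * U r x + lam * (V 0 x * U 0 x)) has_integral E) {-1..c}"
    using energy_identity[OF c(1) smooth_chain_ac_chain[OF V] smooth_chain_ac_chain[OF U']
        negligible_empty ode] bdy(2) unfolding S' SE[symmetric] by simp
  have ci: "(\<lambda>x. F i x * F j x) integrable_on {-1..c}" if "smooth_chain F" for F i j
    by (intro integrable_continuous_interval continuous_intros smooth_chain_continuous_on that)
  define EV where "EV = integral {-1..c} (\<lambda>x. V r x * V r x) + lam * integral {-1..c} (\<lambda>x. V 0 x * V 0 x)"
  define EU where "EU = integral {-1..c} (\<lambda>x. U r x * U r x) + lam * integral {-1..c} (\<lambda>x. U 0 x * U 0 x)"
  have VI: "((\<lambda>x. V r x * V r x + lam * (V 0 x * V 0 x)) has_integral EV) {-1..c}"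
    unfolding EV_def by (intro has_integral_add has_integral_mult_right integrable_integral ci V)
  have UJ: "((\<lambda>x. U r x * U r x + lam * (U 0 x * U 0 x)) has_integral EU) {-1..c}"
    unfolding EU_def by (intro has_integral_add has_integral_mult_right integrable_integral ci U')
  have "EU \<le> E"
    using c lam by (intro has_integral_subset_le[OF _ UJ UI]) auto
  moreover have "E \<le> (EV + EU) / 2"
  proof (rule has_integral_le[OF VU])
    show "((\<lambda>x. ((V r x * V r x + lam * (V 0 x * V 0 x)) + (U r x * U r x + lam * (U 0 x * U 0 x))) / 2)
        has_integral (EV + EU) / 2) {-1..c}"
      by (intro has_integral_divide has_integral_add VI UJ)
    fix x
    have "0 \<le> (V r x - U r x)\<^sup>2 + lam * (V 0 x - U 0 x)\<^sup>2" using lam by simp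
    then show "V r x * U r x + lam * (V 0 x * U 0 x) \<le>
      ((V r x * V r x + lam * (V 0 x * V 0 x)) + (U r x * U r x + lam * (U 0 x * U 0 x))) / 2"
      by (simp add: power2_eq_square algebra_simps)
  qed
  ultimately have "E \<le> EV" by simp
  then show ?thesis
    unfolding E_def EV_def using zero_le_power2[of "norm2 (U r)"] by linarith
qed

text \<open>The competitor is the solution for \<open>lam = 0\<close>, rescaled to a short interval at \<open>-1\<close>.\<close>

lemma norm2_bvp_chain_small:
  assumes k: "k \<le> r - 1" and r: "r \<ge> 1" and e: "e > 0"
  obtains L where "L > 0" "\<And>lam U. lam \<ge> L \<Longrightarrow> bvp_chain r k lam U \<Longrightarrow> (norm2 (U 0))\<^sup>2 \<le> e"
proof -
  obtain Z where Z: "bvp_chain r k 0 Z" using bvp_chain_exists[OF r] by blast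
  note Z' = bvp_chain_smooth[OF Z]
  have "bounded (Z 0 ` \<I>)"
    by (intro compact_imp_bounded compact_continuous_image smooth_chain_continuous_on[OF Z']) auto
  then obtain K where K: "\<And>x. x \<in> \<I> \<Longrightarrow> \<bar>Z 0 x\<bar> \<le> K" 
    unfolding bounded_iff by (force simp del: atLeastAtMost_iff)
  have K0: "K \<ge> 0" using K[of 0] by force
  \<comment> \<open>Chosen so that \<open>2 * h * K\<^sup>2 \<le> e / 2\<close>, while the bound 1
    keeps the interval of length \<open>2 * h\<close> inside \<I>.\<close>
  define h where "h = min 1 (e / (4 * (K\<^sup>2 + 1)))"
  have h: "0 < h" "h \<le> 1" using e by (auto simp: h_def add_nonneg_pos)
  have "h * (4 * (K\<^sup>2 + 1)) \<le> e"
    using mult_right_mono[of h "e / (4 * (K\<^sup>2 + 1))" "4 * (K\<^sup>2 + 1)"]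
    by (simp add: h_def add_nonneg_eq_0_iff) 
  then have hK: "2 * h * K\<^sup>2 \<le> e / 2" using h by (simp add: algebra_simps)
  define c where "c = -1 + 2 * h"
  have c: "-1 \<le> c" "c \<le> 1" using h by (auto simp: c_def)
  \<comment> \<open>The prefactor cancels the scaling of the derivative of order
    \<open>r - k - 1\<close>, the only one with nonzero datum at -1.\<close>
  define V where "V j x = h ^ (r - k - 1) * ((1 / h) ^ j * Z j ((x + 1) / h - 1))" for j x
  have V: "smooth_chain V"
    unfolding smooth_chain_def
  proof (intro allI)
    fix j x
    have "((\<lambda>x. Z j ((x + 1) / h - 1)) has_real_derivative Z (Suc j) ((x + 1) / h - 1) * (1 / h)) (at x)"
      by (rule DERIV_chain2[OF smooth_chain_DERIV[OF Z']]) (use h in \<open>auto intro!: derivative_eq_intros\<close>)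
    then have "((\<lambda>x. h ^ (r - k - 1) * ((1 / h) ^ j * Z j ((x + 1) / h - 1))) has_real_derivative
       h ^ (r - k - 1) * ((1 / h) ^ j * (Z (Suc j) ((x + 1) / h - 1) * (1 / h)))) (at x)"
      by (intro DERIV_cmult)
    then show "(V j has_real_derivative V (Suc j) x) (at x)"
      unfolding V_def by (simp add: mult_ac)
  qed
  define C where "C = integral {-1..c} (\<lambda>x. V r x * V r x)"
  have C: "C \<ge> 0" unfolding C_def by (intro integral_nonneg integrable_continuous_interval continuous_intros
        smooth_chain_continuous_on[OF V]) auto
  have V0: "integral {-1..c} (\<lambda>x. V 0 x * V 0 x) \<le> 2 * h * K\<^sup>2"
  proof -
    have "integral {-1..c} (\<lambda>x. V 0 x * V 0 x) \<le> integral {-1..c} (\<lambda>x. K\<^sup>2)"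
    proof (rule integral_le)
      show "(\<lambda>x. V 0 x * V 0 x) integrable_on {-1..c}"
        by (intro integrable_continuous_interval continuous_intros smooth_chain_continuous_on[OF V])
      fix x assume x: "x \<in> {-1..c}"
      have "(x + 1) / h - 1 \<in> \<I>" using x h by (auto simp: c_def field_simps)
      then have "\<bar>Z 0 ((x + 1) / h - 1)\<bar> \<le> K" by (rule K)
      moreover have "h ^ (r - k - 1) \<le> 1" using h by (intro power_le_one) auto
      ultimately have "\<bar>V 0 x\<bar> \<le> 1 * K"
        unfolding V_def abs_mult using h by (intro mult_mono) auto
      then have "\<bar>V 0 x\<bar> * \<bar>V 0 x\<bar> \<le> K * K" by (intro mult_mono) (use K0 in auto)
      then show "V 0 x * V 0 x \<le> K\<^sup>2" by (simp add: power2_eq_square)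
    qed (simp add: integrable_const_ivl)
    also have "\<dots> = 2 * h * K\<^sup>2" using c by (simp add: c_def)
    finally show ?thesis .
  qed
  \<comment> \<open>From here on the fixed cost \<open>C\<close> is at most
    \<open>lam * (e / 2)\<close>.\<close>
  define L where "L = 2 * C / e + 1"
  have "L > 0" using C e by (simp add: L_def add_nonneg_pos)
  moreover have "(norm2 (U 0))\<^sup>2 \<le> e" if lam: "lam \<ge> L" and U: "bvp_chain r k lam U" for lam U
  proof -
    have lam0: "lam > 0" using lam \<open>L > 0\<close> by simp
    have "lam * (norm2 (U 0))\<^sup>2 \<le> C + lam * integral {-1..c} (\<lambda>x. V 0 x * V 0 x)"
      unfolding C_def
    proof (rule bvp_chain_energy_le[OF _ U c V])
      show "lam \<ge> 0" using lam0 by simp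
      fix s assume s: "s < r"
      show "V s (-1) = U s (-1)"
        using U Z s h by (auto simp: V_def bvp_chain_def power_divide)
      show "V s c = 0"
        using Z s h by (simp add: V_def bvp_chain_def c_def)
    qed
    also have "\<dots> \<le> C + lam * (e / 2)"
      using V0 hK lam0 by (intro add_left_mono mult_left_mono) auto
    also have "C \<le> lam * (e / 2)"
      using lam e by (simp add: L_def field_simps)
    finally have "lam * (norm2 (U 0))\<^sup>2 \<le> lam * e" by (simp add: algebra_simps)
    then show ?thesis using lam0 by simp
  qed
  ultimately show thesis by (rule that)
qed

text \<open>The exponentials \<open>exp (-N * (x + 1))\<close> have norm at most
  \<open>1 / sqrt N\<close> but derivatives of modulus at least 1 at -1. Once
  \<open>norm2 (U 0)\<close> is small enough, the point evaluation bound forces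
  \<open>norm2 (U r) \<ge> sqrt N / 2\<close>.\<close>

lemma norm2_bvp_chain_unbounded:
  assumes k: "k \<le> r - 1" and r: "r \<ge> 1"
  obtains L where "L > 0" "\<And>lam U. lam \<ge> L \<Longrightarrow> bvp_chain r k lam U \<Longrightarrow> norm2 (U r) \<ge> R"
proof -
  obtain n :: nat where n: "real n \<ge> max 1 (4 * R\<^sup>2)" using real_arch_simple by blast
  define N where "N = real n"
  have N: "N \<ge> 1" "N \<ge> 4 * R\<^sup>2" using n by (auto simp: N_def)
  define F where "F j x = (-N) ^ j * exp (-N * (x + 1))" for j :: nat and x :: real
  have F: "smooth_chain F"
    unfolding smooth_chain_def F_def by (auto intro!: derivative_eq_intros)
  have "((\<lambda>x. F 0 x * F 0 x) has_integral (- exp (-2 * N * (1 + 1)) / (2 * N)) - (- exp (-2 * N * (-1 + 1)) / (2 * N))) \<I>"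
  proof (rule fundamental_theorem_of_calculus)
    fix x assume "x \<in> \<I>"
    have "F 0 x * F 0 x = exp (-2 * N * (x + 1))"
      by (simp add: F_def exp_add[symmetric])
    then show "((\<lambda>x. - exp (-2 * N * (x + 1)) / (2 * N)) has_vector_derivative F 0 x * F 0 x) (at x within \<I>)"
      unfolding has_real_derivative_iff_has_vector_derivative[symmetric]
      using N by (auto intro!: derivative_eq_intros)
  qed simp
  then have "(norm2 (F 0))\<^sup>2 = (1 - exp (-4 * N)) / (2 * N)"
    unfolding norm2_square using ip_eq_integral[OF smooth_chain_L2[OF F] smooth_chain_L2[OF F], of 0 0] N
    by (simp add: has_integral_iff field_simps)
  also have "\<dots> \<le> 1 / N" using N by (simp add: field_simps)
  finally have n2: "(norm2 (F 0))\<^sup>2 \<le> 1 / N" .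
  have n1: "norm2 (F 0) \<le> 1 / sqrt N"
    by (rule power2_le_imp_le) (use n2 N in \<open>simp_all add: power_divide\<close>)
  have n1': "norm2 (F 0) \<le> 1"
    by (rule order_trans[OF n1]) (use N in simp)
  have Fr: "norm2 (F r) \<le> N ^ r"
  proof -
    have "F r = (\<lambda>x. (-N) ^ r * F 0 x)" by (simp add: F_def fun_eq_iff)
    then have "norm2 (F r) = \<bar>(-N) ^ r\<bar> * norm2 (F 0)" by (simp only: norm2_cmult)
    also have "\<dots> \<le> N ^ r * 1"
      using n1' N by (intro mult_mono) (auto simp: power_abs)
    finally show ?thesis by simp
  qed
  have Fk: "\<bar>F k (-1)\<bar> \<ge> 1" using N by (simp add: F_def power_abs)
  \<comment> \<open>With \<open>N\<close> fixed, this threshold makes the term with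
    \<open>norm2 (F r)\<close> at most 1/2.\<close>
  have e: "(1 / (2 * N ^ r))\<^sup>2 > 0" using N by simp
  obtain L where L: "L > 0" "\<And>lam U. lam \<ge> L \<Longrightarrow> bvp_chain r k lam U \<Longrightarrow> (norm2 (U 0))\<^sup>2 \<le> (1 / (2 * N ^ r))\<^sup>2"
    using norm2_bvp_chain_small[OF k r e] by blast
  show thesis
  proof (rule that[OF L(1)])
    fix lam U assume lam: "lam \<ge> L" and U: "bvp_chain r k lam U"
    have B: "norm2 (U 0) \<le> 1 / (2 * N ^ r)"
      by (rule power2_le_imp_le[OF L(2)[OF lam U]]) (use N in simp)
    have "1 \<le> \<bar>F k (-1)\<bar>" by (rule Fk)
    also have "\<dots> \<le> norm2 (U r) * norm2 (F 0) + norm2 (U 0) * norm2 (F r)"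
      by (rule point_evaluation_bound[OF k r U smooth_chain_ac_chain[OF F] smooth_chain_L2[OF F] smooth_chain_L2[OF F]])
    also have "\<dots> \<le> norm2 (U r) * (1 / sqrt N) + 1 / (2 * N ^ r) * N ^ r"
      using n1 B Fr N by (intro add_mono mult_mono) auto
    also have "1 / (2 * N ^ r) * N ^ r = 1 / 2" using N by simp
    finally have "sqrt N / 2 \<le> norm2 (U r)" using N by (simp add: field_simps)
    moreover have "R \<le> sqrt N / 2"
      using N(2) real_le_rsqrt[of "2 * R" N] by (simp add: power_mult_distrib)
    ultimately show "R \<le> norm2 (U r)" by simp
  qed
qed

section \<open>Characterisation of the set of sharp pairs\<close>

theorem theorem2:
  fixes r k :: nat
  assumes "r \<ge> 1" and "k \<le> r - 1"
  shows "Gamma_left r k =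
    {(norm2 (deriv_I r (u_sol r k lam)), norm2 (u_sol r k lam)) | lam::real. lam \<ge> 0}"
proof -
  note r = assms(1) and k = assms(2)
  define U where "U lam = (SOME U. bvp_chain r k lam U)" for lam
  have U: "bvp_chain r k lam (U lam)" if "lam \<ge> 0" for lam
    unfolding U_def using bvp_chain_exists[OF r that] by (rule someI_ex)
  have rhs: "{(norm2 (deriv_I r (u_sol r k lam)), norm2 (u_sol r k lam)) | lam::real. lam \<ge> 0}
     = {(norm2 (U lam r), norm2 (U lam 0)) | lam::real. lam \<ge> 0}"
    using norm2_u_sol[OF r _ U] by (intro Collect_cong) (metis (no_types, lifting))
  have "(norm2 (U lam r), norm2 (U lam 0)) \<in> Gamma_left r k" if lam: "lam \<ge> 0" for lam
    unfolding Gamma_left_def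
    using L2_space_bound[OF k r U[OF lam]] B_left_bvp_chain[OF k r lam U[OF lam]] by simp
  moreover have "\<exists>lam\<ge>0. A = norm2 (U lam r) \<and> B = norm2 (U lam 0)" if "(A, B) \<in> Gamma_left r k" for A B
  proof -
    have A: "A \<ge> 0" and ineq: "\<And>f. f \<in> L2_space r \<Longrightarrow> \<bar>deriv_I k f (-1)\<bar> \<le> A * norm2 f + B * norm2 (deriv_I r f)"
      and B: "ereal B = B_left r k A"
      using that by (auto simp: Gamma_left_def)
    \<comment> \<open>For the test function below the term with \<open>B\<close> disappears, so the
      inequality bounds \<open>A\<close> from below.\<close>
    have "norm2 (U 0 r) \<le> A"
    proof -
      define F where "F j = U 0 (r + j)" for j
      have F: "smooth_chain F"
        unfolding F_def by (intro smooth_chain_shift bvp_chain_smooth[OF U]) simp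
      define f where "f = restrict (F 0) \<I>"
      have f: "f \<in> L2_space r" unfolding f_def by (rule smooth_chain_L2_space[OF F])
      have fk: "deriv_I k f (-1) = F k (-1)" unfolding f_def by (rule smooth_chain_deriv_I[OF F]) simp
      have Fr: "F r = (\<lambda>x. 0)" using U[of 0] by (simp add: F_def bvp_chain_def fun_eq_iff)
      have nf: "norm2 f = norm2 (U 0 r)"
        unfolding f_def using smooth_chain_norm2[OF F, of 0] by (simp add: F_def)
      have nfr: "norm2 (deriv_I r f) = 0"
        unfolding f_def smooth_chain_norm2[OF F] Fr by (simp add: norm2_def)
      have "F k (-1) = ip (F 0) (U 0 r) - (-1) ^ r * ip (F r) (U 0 0)"
        by (rule point_evaluation_identity[OF k r U smooth_chain_ac_chain[OF F] smooth_chain_L2[OF F] smooth_chain_L2[OF F]]) simp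
      also have "\<dots> = (norm2 (U 0 r))\<^sup>2"
        unfolding Fr norm2_square by (simp add: F_def ip_def)
      finally have "(norm2 (U 0 r))\<^sup>2 \<le> A * norm2 (U 0 r)"
        using ineq[OF f] unfolding fk nf nfr by simp
      then show ?thesis
        using A norm2_nonneg[of "U 0 r"] by (cases "norm2 (U 0 r) = 0") (auto simp: power2_eq_square)
    qed
    moreover obtain L where "L > 0" "A \<le> norm2 (U L r)"
      using norm2_bvp_chain_unbounded[OF k r, of A] U by (metis order_refl less_imp_le)
    moreover have "continuous_on {0..L} (\<lambda>lam. norm2 (U lam r))"
      by (rule continuous_on_subset[OF continuous_on_norm2_bvp_chain[OF U]]) auto
    ultimately obtain lam where lam: "0 \<le> lam" "norm2 (U lam r) = A"
      using IVT'[of "\<lambda>lam. norm2 (U lam r)" 0 A L] by (metis less_imp_le)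
    \<comment> \<open>Sharpness makes \<open>B\<close> a function of \<open>A\<close>, so matching
      the first components is enough.\<close>
    then have "B = norm2 (U lam 0)"
      using B B_left_bvp_chain[OF k r lam(1) U[OF lam(1)]] by simp
    then show ?thesis using lam by blast
  qed
  ultimately show ?thesis unfolding rhs by auto blast
qed

end
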